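(* Let $X$ be a CBB$(0)$ space, let $Y$ be a complete CAT$(0)$ space and let $A \subseteq X$ be nonempty. Then there exists a continuous mapping $\beta : \mathcal{L}(A,Y) \to \mathcal{L}(X,Y)$ such that for all $g \in \mathcal{L}(A,Y)$, $\beta(g)(a) = g(a)$ for every $a \in A$ and $\mathrm{Lip}(\beta(g),X) = \mathrm{Lip}(g,A)$.
   Context: A geodesic space is CAT$(0)$ if for every geodesic triangle, distances between points on the triangle are $\le$ distances between corresponding points of its Euclidean comparison triangle; it is CBB$(0)$ if the reversed inequality ($\ge$) holds. $\mathcal{L}(A,Y)$ is the set of bounded Lipschitz maps $A\to Y$ with the supremum metric $d_\infty(f,g)=\sup_{x\in A}d_Y(f(x),g(x))$; continuity refers to these metrics. $\mathrm{Lip}(f,B)=\sup\{d_Y(f(x),f(y))/d(x,y):x,y\in B,x\ne y\}$. *)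

theory Defs
  imports "HOL-Analysis.Analysis"
begin

definition geodesic_path :: "'a::metric_space set \<Rightarrow> (real \<Rightarrow> 'a) \<Rightarrow> 'a \<Rightarrow> 'a \<Rightarrow> bool" where
  "geodesic_path S g x y \<longleftrightarrow>
     g ` {0..dist x y} \<subseteq> S \<and> g 0 = x \<and> g (dist x y) = y \<and>
     (\<forall>s\<in>{0..dist x y}. \<forall>t\<in>{0..dist x y}. dist (g s) (g t) = \<bar>s - t\<bar>)"

definition geodesic_space :: "'a::metric_space set \<Rightarrow> bool" where
  "geodesic_space S \<longleftrightarrow> (\<forall>x\<in>S. \<forall>y\<in>S. \<exists>g. geodesic_path S g x y)"

text \<open>Pairs (point on the side g from x to y, corresponding point on the Euclidean
  comparison side from a to b), Euclidean plane modelled by complex.\<close>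
definition side_pairs :: "(real \<Rightarrow> 'a::metric_space) \<Rightarrow> 'a \<Rightarrow> 'a \<Rightarrow> complex \<Rightarrow> complex \<Rightarrow> ('a \<times> complex) set" where
  "side_pairs g x y a b =
     {(g t, a + complex_of_real (t / dist x y) * (b - a)) | t. 0 \<le> t \<and> t \<le> dist x y}"

definition triangle_pairs ::
  "'a::metric_space \<Rightarrow> 'a \<Rightarrow> 'a \<Rightarrow> (real \<Rightarrow> 'a) \<Rightarrow> (real \<Rightarrow> 'a) \<Rightarrow> (real \<Rightarrow> 'a)
   \<Rightarrow> complex \<Rightarrow> complex \<Rightarrow> complex \<Rightarrow> ('a \<times> complex) set" where
  "triangle_pairs x1 x2 x3 g12 g23 g31 c1 c2 c3 =
     side_pairs g12 x1 x2 c1 c2 \<union> side_pairs g23 x2 x3 c2 c3 \<union> side_pairs g31 x3 x1 c3 c1"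

definition comparison_triangle ::
  "'a::metric_space set \<Rightarrow> 'a \<Rightarrow> 'a \<Rightarrow> 'a \<Rightarrow> (real \<Rightarrow> 'a) \<Rightarrow> (real \<Rightarrow> 'a) \<Rightarrow> (real \<Rightarrow> 'a)
   \<Rightarrow> complex \<Rightarrow> complex \<Rightarrow> complex \<Rightarrow> bool" where
  "comparison_triangle S x1 x2 x3 g12 g23 g31 c1 c2 c3 \<longleftrightarrow>
     x1 \<in> S \<and> x2 \<in> S \<and> x3 \<in> S \<and>
     geodesic_path S g12 x1 x2 \<and> geodesic_path S g23 x2 x3 \<and> geodesic_path S g31 x3 x1 \<and>
     dist c1 c2 = dist x1 x2 \<and> dist c2 c3 = dist x2 x3 \<and> dist c3 c1 = dist x3 x1"

definition CAT0 :: "'a::metric_space set \<Rightarrow> bool" where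
  "CAT0 S \<longleftrightarrow> geodesic_space S \<and>
     (\<forall>x1 x2 x3 g12 g23 g31 c1 c2 c3. comparison_triangle S x1 x2 x3 g12 g23 g31 c1 c2 c3 \<longrightarrow>
        (\<forall>(p, p') \<in> triangle_pairs x1 x2 x3 g12 g23 g31 c1 c2 c3.
         \<forall>(q, q') \<in> triangle_pairs x1 x2 x3 g12 g23 g31 c1 c2 c3. dist p q \<le> dist p' q'))"

definition CBB0 :: "'a::metric_space set \<Rightarrow> bool" where
  "CBB0 S \<longleftrightarrow> geodesic_space S \<and>
     (\<forall>x1 x2 x3 g12 g23 g31 c1 c2 c3. comparison_triangle S x1 x2 x3 g12 g23 g31 c1 c2 c3 \<longrightarrow>
        (\<forall>(p, p') \<in> triangle_pairs x1 x2 x3 g12 g23 g31 c1 c2 c3.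
         \<forall>(q, q') \<in> triangle_pairs x1 x2 x3 g12 g23 g31 c1 c2 c3. dist p q \<ge> dist p' q'))"

text \<open>Bounded Lipschitz maps A \<rightarrow> Y (only values on A matter).\<close>
definition Lmaps :: "'a::metric_space set \<Rightarrow> ('a \<Rightarrow> 'b::metric_space) set" where
  "Lmaps A = {f. bounded (f ` A) \<and> (\<exists>L. L-lipschitz_on A f)}"

definition sup_dist :: "'a set \<Rightarrow> ('a \<Rightarrow> 'b::metric_space) \<Rightarrow> ('a \<Rightarrow> 'b) \<Rightarrow> real" where
  "sup_dist A f g = (SUP x\<in>A. dist (f x) (g x))"

text \<open>Lip(f,B); the 0 makes the supremum of the empty set (|B| \<le> 1) equal to 0.\<close>
definition Lip :: "('a::metric_space \<Rightarrow> 'b::metric_space) \<Rightarrow> 'a set \<Rightarrow> real" where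
  "Lip f B = Sup ({0} \<union> {dist (f x) (f y) / dist x y | x y. x \<in> B \<and> y \<in> B \<and> x \<noteq> y})"

end

(* Curvature enters only through two inequalities for an interpolation c t x y along geodesics: the CN
   inequality in Y and its reverse in X. From the reverse one, the Lang-Schroeder inequality
     sum_ij w_i w_j (d(x,x_i)^2 + d(x,x_j)^2 - d(x_i,x_j)^2) >= 0
   follows by induction on the number of points: X is almost a flat sector close to x, so after
   contracting towards x two points can be merged into a point between them. From the CN inequality, a
   minimax argument shows that balls in Y satisfying the matching inequality for radii and centres
   intersect. Together with Zorn's lemma this extends Lipschitz maps without increasing the constant.

   Applying the extension to two parallel copies of X shows that a map F on X has an extension of h
   nearby whenever h is close to F on A. Since Lip is only lower semicontinuous, F is first contracted
   towards a point. So the extensions with optimal constant form a lower semicontinuous, closed and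
   convex valued multimap, and Michael's selection argument provides a continuous selection. *)

theory Submission
  imports Defs
begin

subsection \<open>Comparison inequalities\<close>

text \<open>No local compactness is available: balls of \<open>Y\<close> need not be compact, and
  geodesics of \<open>X\<close> need be neither unique nor extendable. A tangent cone is therefore
  replaced by points at a small positive distance from \<open>x\<close>, with an error that is
  negligible at that scale, and compactness of balls by completeness together with the quadratic
  growth of convex combinations of squared distances. The distance between the two copies comes from
  one computation. If \<open>F\<close> and \<open>h\<close> are \<open>e\<close>-close on
  \<open>A\<close>, then d(h a, F x) is at most lam * d(a, x) + e, and the square of this exceeds
  (lam * d(a, x))^2 by 2 * lam * d(a, x) * e + e^2, which is unbounded in \<open>x\<close>.
  Boundedness of the maps repairs this: if values differ by at most \<open>R\<close>, only pairs
  with lam * d(a, x) <= R matter, and squared distance 2 * R * e + e^2 suffices. In the selection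
  argument a partition of unity has no convex combinations to feed. Successive moves along geodesics
  take their place; their result depends on the order, which the levels of the cells
  provide.\<close>

lemma comparison_points_exist:
  fixes x y z :: "'a::metric_space"
  obtains c1 c2 c3 :: complex
  where "dist c1 c2 = dist x y" "dist c2 c3 = dist y z" "dist c3 c1 = dist z x"
proof (cases "x = y")
  case True
  show ?thesis
    by (rule that[of 0 0 "complex_of_real (dist y z)"]) (use True in \<open>auto simp: dist_norm dist_commute\<close>)
next
  case False
  define l where "l = dist x y"
  define a where "a = dist y z"
  define b where "b = dist z x"
  \<comment> \<open>The first side lies on the real axis. The law of cosines gives the abscissa
    \<open>u\<close> of the third vertex, and the triangle inequalities give |u| <= b.\<close>
  define u where "u = (l\<^sup>2 + b\<^sup>2 - a\<^sup>2) / (2 * l)"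
  have l: "l > 0" using False by (simp add: l_def)
  have tri: "l \<le> a + b" "a \<le> l + b" "b \<le> l + a" "a \<ge> 0" "b \<ge> 0"
    using dist_triangle[of x y z] dist_triangle[of y z x] dist_triangle[of z x y]
    by (auto simp: l_def a_def b_def dist_commute)
  have u2: "2 * l * u = l\<^sup>2 + b\<^sup>2 - a\<^sup>2" using l by (simp add: u_def)
  have "2 * l * u \<le> 2 * l * b"
  proof -
    have "(l - b)\<^sup>2 \<le> a\<^sup>2" by (rule abs_le_square_iff[THEN iffD1]) (use tri in auto)
    then show ?thesis using u2 by (simp add: power2_eq_square algebra_simps)
  qed
  moreover have "2 * l * u \<ge> 2 * l * (- b)"
  proof -
    have "a\<^sup>2 \<le> (l + b)\<^sup>2" by (rule power_mono) (use tri in auto)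
    then show ?thesis using u2 by (simp add: power2_eq_square algebra_simps)
  qed
  ultimately have "u \<le> b" "- b \<le> u" using mult_left_le_imp_le[of "2 * l"] l by (metis mult_pos_pos zero_less_numeral)+
  then have "\<bar>u\<bar> \<le> b" by linarith
  then have ub: "u\<^sup>2 \<le> b\<^sup>2" using abs_le_square_iff[of u b] tri by simp
  define c3 where "c3 = Complex u (sqrt (b\<^sup>2 - u\<^sup>2))"
  have v: "(sqrt (b\<^sup>2 - u\<^sup>2))\<^sup>2 = b\<^sup>2 - u\<^sup>2" using ub by simp
  have "(dist c3 0)\<^sup>2 = b\<^sup>2"
    using v by (simp add: dist_norm cmod_power2 c3_def)
  then have d3: "dist c3 0 = b" using tri by (simp add: power2_eq_iff_nonneg)
  have "(dist (complex_of_real l) c3)\<^sup>2 = (l - u)\<^sup>2 + (b\<^sup>2 - u\<^sup>2)"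
    using v by (simp add: dist_norm cmod_power2 c3_def)
  also have "\<dots> = a\<^sup>2" using u2 by (simp add: power2_eq_square algebra_simps)
  finally have d2: "dist (complex_of_real l) c3 = a" using tri by (simp add: power2_eq_iff_nonneg)
  have d1: "dist 0 (complex_of_real l) = l" using l by (simp add: dist_norm)
  show ?thesis
    by (rule that[of 0 "complex_of_real l" c3]) (use d1 d2 d3 in \<open>auto simp: l_def a_def b_def\<close>)
qed

text \<open>Stewart's theorem. It turns the comparison of a vertex with a point of the opposite side
  into an inequality free of comparison triangles.\<close>

lemma stewart:
  fixes a b c :: complex
  shows "(dist c (a + complex_of_real t * (b - a)))\<^sup>2 =
    (1 - t) * (dist c a)\<^sup>2 + t * (dist c b)\<^sup>2 - t * (1 - t) * (dist a b)\<^sup>2"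
  by (simp add: dist_norm cmod_power2) (simp add: power2_eq_square algebra_simps)

text \<open>\<open>c t x y\<close> stands for a point on a chosen geodesic, known only through its
  distances to the ends: reversing or subdividing the geodesic may lead to another choice. Halving
  is therefore iterated below, so that each point is the midpoint of \<open>x\<close> and its
  predecessor.\<close>

locale interpolation =
  fixes c :: "real \<Rightarrow> 'a::metric_space \<Rightarrow> 'a \<Rightarrow> 'a"
  assumes dist_left: "\<lbrakk>0 \<le> t; t \<le> 1\<rbrakk> \<Longrightarrow> dist x (c t x y) = t * dist x y"
    and dist_right: "\<lbrakk>0 \<le> t; t \<le> 1\<rbrakk> \<Longrightarrow> dist (c t x y) y = (1 - t) * dist x y"

locale cat0_interpolation = interpolation c for c :: "real \<Rightarrow> 'a::metric_space \<Rightarrow> 'a \<Rightarrow> 'a" +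
  assumes CN: "\<lbrakk>0 \<le> t; t \<le> 1\<rbrakk> \<Longrightarrow>
    (dist z (c t x y))\<^sup>2 \<le> (1 - t) * (dist z x)\<^sup>2 + t * (dist z y)\<^sup>2 - t * (1 - t) * (dist x y)\<^sup>2"

locale cbb0_interpolation = interpolation c for c :: "real \<Rightarrow> 'a::metric_space \<Rightarrow> 'a \<Rightarrow> 'a" +
  assumes reverse_CN: "\<lbrakk>0 \<le> t; t \<le> 1\<rbrakk> \<Longrightarrow>
    (dist z (c t x y))\<^sup>2 \<ge> (1 - t) * (dist z x)\<^sup>2 + t * (dist z y)\<^sup>2 - t * (1 - t) * (dist x y)\<^sup>2"

lemma geodesic_space_interpolation:
  assumes "geodesic_space (UNIV :: 'a::metric_space set)"
  obtains G :: "'a::metric_space \<Rightarrow> 'a \<Rightarrow> real \<Rightarrow> 'a"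
  where "\<And>x y. geodesic_path UNIV (G x y) x y"
    and "interpolation (\<lambda>t x y. G x y (t * dist x y))"
proof -
  have "\<forall>x y :: 'a. \<exists>g. geodesic_path UNIV g x y"
    using assms by (auto simp: geodesic_space_def)
  then obtain G :: "'a \<Rightarrow> 'a \<Rightarrow> real \<Rightarrow> 'a" where G: "\<And>x y. geodesic_path UNIV (G x y) x y"
    by metis
  have *: "dist (G x y s) (G x y t) = \<bar>s - t\<bar>"
    if "0 \<le> s" "s \<le> dist x y" "0 \<le> t" "t \<le> dist x y" for x y s t
    using G[of x y] that by (simp add: geodesic_path_def)
  have ends: "G x y 0 = x" "G x y (dist x y) = y" for x y
    using G[of x y] by (auto simp: geodesic_path_def)
  have "interpolation (\<lambda>t x y. G x y (t * dist x y))"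
  proof
    fix t :: real and x y :: 'a
    assume t: "0 \<le> t" "t \<le> 1"
    have r: "0 \<le> t * dist x y" "t * dist x y \<le> dist x y"
      using t by (auto simp: mult_left_le_one_le)
    show "dist x (G x y (t * dist x y)) = t * dist x y"
      using *[of 0 x y "t * dist x y"] r by (simp add: ends)
    show "dist (G x y (t * dist x y)) y = (1 - t) * dist x y"
      using *[of "t * dist x y" x y "dist x y"] r by (simp add: ends algebra_simps)
  qed
  then show ?thesis using that G by blast
qed

text \<open>For a vertex and a point of the opposite side the comparison distance is explicit; this
  is the case that yields CN and its reverse.\<close>

lemma comparison_point_pairs:
  assumes G: "\<And>x y. geodesic_path (UNIV :: 'a::metric_space set) (G x y) x y"
    and t: "0 \<le> t" "t \<le> 1" and "x \<noteq> y"
  obtains c1 c2 c3 q'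
  where "comparison_triangle UNIV x y z (G x y) (G y z) (G z x) c1 c2 c3"
    and "(z, c3) \<in> triangle_pairs x y z (G x y) (G y z) (G z x) c1 c2 c3"
    and "(G x y (t * dist x y), q') \<in> triangle_pairs x y z (G x y) (G y z) (G z x) c1 c2 c3"
    and "(dist c3 q')\<^sup>2 = (1 - t) * (dist z x)\<^sup>2 + t * (dist z y)\<^sup>2 - t * (1 - t) * (dist x y)\<^sup>2"
proof -
  obtain c1 c2 c3 :: complex where c: "dist c1 c2 = dist x y" "dist c2 c3 = dist y z" "dist c3 c1 = dist z x"
    by (rule comparison_points_exist)
  define q' where "q' = c1 + complex_of_real t * (c2 - c1)"
  have "comparison_triangle UNIV x y z (G x y) (G y z) (G z x) c1 c2 c3"
    using G c by (simp add: comparison_triangle_def)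
  moreover have "(z, c3) \<in> side_pairs (G z x) z x c3 c1"
    using G[of z x] by (auto simp: side_pairs_def geodesic_path_def intro!: exI[of _ 0])
  moreover have "(G x y (t * dist x y), q') \<in> side_pairs (G x y) x y c1 c2"
    unfolding side_pairs_def q'_def using t \<open>x \<noteq> y\<close>
    by (auto intro!: exI[of _ "t * dist x y"] simp: mult_left_le_one_le)
  moreover have "(dist c3 q')\<^sup>2 = (1 - t) * (dist z x)\<^sup>2 + t * (dist z y)\<^sup>2 - t * (1 - t) * (dist x y)\<^sup>2"
    unfolding q'_def stewart using c by (simp add: dist_commute)
  ultimately show ?thesis using that by (auto simp: triangle_pairs_def)
qed

lemma CAT0_interpolation:
  assumes "CAT0 (UNIV :: 'a::metric_space set)"
  obtains c :: "real \<Rightarrow> 'a::metric_space \<Rightarrow> 'a \<Rightarrow> 'a" where "cat0_interpolation c"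
proof -
  have "geodesic_space (UNIV :: 'a set)"
    using assms by (simp add: CAT0_def)
  then obtain G :: "'a \<Rightarrow> 'a \<Rightarrow> real \<Rightarrow> 'a" where G: "\<And>x y. geodesic_path UNIV (G x y) x y"
    and int: "interpolation (\<lambda>t x y. G x y (t * dist x y))"
    by (rule geodesic_space_interpolation) blast
  have "(dist z (G x y (t * dist x y)))\<^sup>2
      \<le> (1 - t) * (dist z x)\<^sup>2 + t * (dist z y)\<^sup>2 - t * (1 - t) * (dist x y)\<^sup>2"
    if t: "0 \<le> t" "t \<le> 1" for t x y z
  proof (cases "x = y")
    case True
    then show ?thesis using G[of x x] by (auto simp: geodesic_path_def algebra_simps)
  next
    case False
    obtain c1 c2 c3 q'
      where "comparison_triangle UNIV x y z (G x y) (G y z) (G z x) c1 c2 c3"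
        and "(z, c3) \<in> triangle_pairs x y z (G x y) (G y z) (G z x) c1 c2 c3"
        and "(G x y (t * dist x y), q') \<in> triangle_pairs x y z (G x y) (G y z) (G z x) c1 c2 c3"
        and q': "(dist c3 q')\<^sup>2 = (1 - t) * (dist z x)\<^sup>2 + t * (dist z y)\<^sup>2 - t * (1 - t) * (dist x y)\<^sup>2"
      by (rule comparison_point_pairs[where G = G and x = x and y = y and z = z and t = t, OF G t False])
    with assms have "dist z (G x y (t * dist x y)) \<le> dist c3 q'"
      unfolding CAT0_def by blast
    then show ?thesis
      unfolding q'[symmetric] by (simp add: power_mono)
  qed
  then have "cat0_interpolation (\<lambda>t x y. G x y (t * dist x y))"
    using int by (simp add: cat0_interpolation_def cat0_interpolation_axioms_def)
  then show ?thesis by (rule that)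
qed

lemma CBB0_interpolation:
  assumes "CBB0 (UNIV :: 'a::metric_space set)"
  obtains c :: "real \<Rightarrow> 'a::metric_space \<Rightarrow> 'a \<Rightarrow> 'a" where "cbb0_interpolation c"
proof -
  have "geodesic_space (UNIV :: 'a set)"
    using assms by (simp add: CBB0_def)
  then obtain G :: "'a \<Rightarrow> 'a \<Rightarrow> real \<Rightarrow> 'a" where G: "\<And>x y. geodesic_path UNIV (G x y) x y"
    and int: "interpolation (\<lambda>t x y. G x y (t * dist x y))"
    by (rule geodesic_space_interpolation) blast
  have "(dist z (G x y (t * dist x y)))\<^sup>2
      \<ge> (1 - t) * (dist z x)\<^sup>2 + t * (dist z y)\<^sup>2 - t * (1 - t) * (dist x y)\<^sup>2"
    if t: "0 \<le> t" "t \<le> 1" for t x y z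
  proof (cases "x = y")
    case True
    then show ?thesis using G[of x x] by (auto simp: geodesic_path_def algebra_simps)
  next
    case False
    obtain c1 c2 c3 q'
      where "comparison_triangle UNIV x y z (G x y) (G y z) (G z x) c1 c2 c3"
        and "(z, c3) \<in> triangle_pairs x y z (G x y) (G y z) (G z x) c1 c2 c3"
        and "(G x y (t * dist x y), q') \<in> triangle_pairs x y z (G x y) (G y z) (G z x) c1 c2 c3"
        and q': "(dist c3 q')\<^sup>2 = (1 - t) * (dist z x)\<^sup>2 + t * (dist z y)\<^sup>2 - t * (1 - t) * (dist x y)\<^sup>2"
      by (rule comparison_point_pairs[where G = G and x = x and y = y and z = z and t = t, OF G t False])
    with assms have "dist z (G x y (t * dist x y)) \<ge> dist c3 q'"
      unfolding CBB0_def by blast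
    then show ?thesis
      unfolding q'[symmetric] by (simp add: power_mono)
  qed
  then have "cbb0_interpolation (\<lambda>t x y. G x y (t * dist x y))"
    using int by (simp add: cbb0_interpolation_def cbb0_interpolation_axioms_def)
  then show ?thesis by (rule that)
qed

subsection \<open>The Lang--Schroeder inequality\<close>

context interpolation
begin

lemma c_0 [simp]: "c 0 x y = x"
  using dist_left[of 0 x y] by simp

lemma c_1 [simp]: "c 1 x y = y"
  using dist_right[of 1 x y] by simp

lemma c_same [simp]: "\<lbrakk>0 \<le> t; t \<le> 1\<rbrakk> \<Longrightarrow> c t x x = x"
  using dist_left[of t x x] by simp

end

text \<open>The inner product at \<open>x\<close> of the comparison vectors towards \<open>a\<close> and \<open>b\<close>.\<close>

definition cprod :: "'a::metric_space \<Rightarrow> 'a \<Rightarrow> 'a \<Rightarrow> real" where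
  "cprod x a b = ((dist x a)\<^sup>2 + (dist x b)\<^sup>2 - (dist a b)\<^sup>2) / 2"

lemma cprod_commute: "cprod x a b = cprod x b a"
  by (simp add: cprod_def dist_commute)

lemma cprod_same [simp]: "cprod x a a = (dist x a)\<^sup>2"
  by (simp add: cprod_def)

lemma cprod_ge: "cprod x a b \<ge> - (dist x a * dist x b)"
proof -
  have "(dist a b)\<^sup>2 \<le> (dist x a + dist x b)\<^sup>2"
    by (rule power_mono) (use dist_triangle3[of a b x] in auto)
  then show ?thesis by (simp add: cprod_def power2_eq_square algebra_simps)
qed

context cbb0_interpolation
begin

abbreviation halve :: "'a \<Rightarrow> 'a \<Rightarrow> 'a" where
  "halve x \<equiv> c (1/2) x"

lemma dist_halve: "dist x (halve x a) = dist x a / 2"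
  using dist_left[of "1/2" x a] by simp

text \<open>Monotonicity of angles: in nonnegative curvature the comparison angle at
  \<open>x\<close> does not decrease when \<open>a\<close> moves towards \<open>x\<close>, so the
  product drops at least as fast as the length.\<close>

lemma cprod_halve: "cprod x (halve x a) b \<le> cprod x a b / 2"
  using reverse_CN[of "1/2" b x a]
  by (simp add: cprod_def dist_halve dist_commute power2_eq_square field_simps)

lemma dist_funpow_halve: "dist x ((halve x ^^ n) a) = dist x a / 2 ^ n"
  by (induction n) (auto simp: dist_halve)

lemma cprod_funpow_halve_left: "cprod x ((halve x ^^ n) a) b \<le> cprod x a b / 2 ^ n"
proof (induction n)
  case (Suc n)
  have "cprod x ((halve x ^^ Suc n) a) b \<le> cprod x ((halve x ^^ n) a) b / 2"
    using cprod_halve by simp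
  also have "\<dots> \<le> cprod x a b / 2 ^ Suc n"
    using Suc by (simp add: field_simps)
  finally show ?case .
qed simp

lemma cprod_funpow_halve: "cprod x ((halve x ^^ n) a) ((halve x ^^ n) b) \<le> cprod x a b / 4 ^ n"
proof -
  have "cprod x ((halve x ^^ n) a) ((halve x ^^ n) b) \<le> cprod x a ((halve x ^^ n) b) / 2 ^ n"
    by (rule cprod_funpow_halve_left)
  also have "\<dots> \<le> (cprod x a b / 2 ^ n) / 2 ^ n"
    using cprod_funpow_halve_left[of x n b a]
    by (intro divide_right_mono) (auto simp: cprod_commute)
  also have "\<dots> = cprod x a b / 4 ^ n"
    by (simp add: power_mult_distrib[symmetric])
  finally show ?thesis .
qed

text \<open>Near \<open>x\<close> the space is almost a cone, in which the directions towards \<open>a\<close> and \<open>b\<close> span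
  a flat sector: the rescaled comparison product decreases along halving, hence it converges.\<close>

lemma cprod_scaled_almost_constant:
  assumes "e > 0"
  obtains n where
    "4 ^ n * cprod x ((halve x ^^ n) a) ((halve x ^^ n) b)
     \<le> 4 ^ Suc n * cprod x ((halve x ^^ Suc n) a) ((halve x ^^ Suc n) b) + e"
proof -
  define J where "J n = 4 ^ n * cprod x ((halve x ^^ n) a) ((halve x ^^ n) b)" for n
  have "J (Suc n) \<le> J n" for n
    using cprod_funpow_halve[of x 1 "(halve x ^^ n) a" "(halve x ^^ n) b"]
    by (simp add: J_def)
  then have dec: "decseq J" by (simp add: decseq_Suc_iff)
  have "J n \<ge> - (dist x a * dist x b)" for n
    using cprod_ge[of x "(halve x ^^ n) a" "(halve x ^^ n) b"]
    by (simp add: J_def dist_funpow_halve field_simps power_mult_distrib[symmetric])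
  then obtain l where "J \<longlonglongrightarrow> l"
    using decseq_convergent[OF dec] by blast
  then have "(\<lambda>n. J n - J (Suc n)) \<longlonglongrightarrow> l - l"
    by (intro tendsto_diff LIMSEQ_Suc)
  then have "eventually (\<lambda>n. J n - J (Suc n) < e) sequentially"
    using order_tendstoD(2)[of _ "l - l"] assms by simp
  then obtain n where "J n - J (Suc n) < e"
    by (auto simp: eventually_sequentially)
  then show ?thesis using that[of n] by (simp add: J_def)
qed

text \<open>In a flat sector the point \<open>m\<close> at ratio \<open>l\<close> between the halved
  points satisfies both relations with equality and without error. The obstacle is that reverse CN
  bounds distances to interpolated points from below, whereas \<open>dist x m\<close> needs an upper
  bound. The way out is to look beyond \<open>a1\<close> at \<open>a2\<close>: since
  \<open>a1\<close> is the midpoint of \<open>x\<close> and \<open>a2\<close>, a lower bound for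
  \<open>dist m a2\<close> limits \<open>dist x m\<close>.\<close>

lemma merge_two_points:
  assumes l: "0 \<le> l" "l \<le> 1" and "e > 0"
  obtains n m where
    "(dist x m)\<^sup>2 \<le> (1 - l)\<^sup>2 * cprod x ((halve x ^^ n) a) ((halve x ^^ n) a)
        + l\<^sup>2 * cprod x ((halve x ^^ n) b) ((halve x ^^ n) b)
        + 2 * l * (1 - l) * cprod x ((halve x ^^ n) a) ((halve x ^^ n) b) + e / 4 ^ n"
    "\<And>z. cprod x m z \<le> (1 - l) * cprod x ((halve x ^^ n) a) z
        + l * cprod x ((halve x ^^ n) b) z + e / 4 ^ n"
proof -
  have "e / 4 > 0" using \<open>e > 0\<close> by simp
  then obtain k where k: "4 ^ k * cprod x ((halve x ^^ k) a) ((halve x ^^ k) b)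
     \<le> 4 ^ Suc k * cprod x ((halve x ^^ Suc k) a) ((halve x ^^ Suc k) b) + e / 4"
    by (rule cprod_scaled_almost_constant)
  define a2 b2 a1 b1 where "a2 = (halve x ^^ k) a" and "b2 = (halve x ^^ k) b"
    and "a1 = halve x a2" and "b1 = halve x b2"
  have S: "(halve x ^^ Suc k) a = a1" "(halve x ^^ Suc k) b = b1"
    by (simp_all add: a1_def b1_def a2_def b2_def)
  define m where "m = c l a1 b1"
  define E where "E = e / 4 ^ Suc k"
  have "E > 0" using \<open>e > 0\<close> by (simp add: E_def)
  have k': "cprod x a2 b2 \<le> 4 * cprod x a1 b1 + E"
  proof -
    have "4 ^ k * E = e / 4" by (simp add: E_def)
    moreover have "4 ^ k * cprod x a2 b2 \<le> 4 * 4 ^ k * cprod x a1 b1 + e / 4"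
      using k unfolding S a2_def b2_def by simp
    moreover have "4 ^ k * (4 * cprod x a1 b1 + E) = 4 * 4 ^ k * cprod x a1 b1 + 4 ^ k * E"
      by (simp add: algebra_simps)
    ultimately have "4 ^ k * cprod x a2 b2 \<le> 4 ^ k * (4 * cprod x a1 b1 + E)"
      by linarith
    then show ?thesis by simp
  qed
  define A B D where "A = (dist x a1)\<^sup>2" and "B = (dist x b1)\<^sup>2" and "D = (dist a1 b1)\<^sup>2"
  define J where "J = cprod x a1 b1"
  have D: "D = A + B - 2 * J" by (simp add: J_def cprod_def A_def B_def D_def field_simps)
  have a2x: "dist x a2 = 2 * dist x a1" and a2: "dist a1 a2 = dist x a1"
    using dist_left[of "1/2" x a2] dist_right[of "1/2" x a2] by (auto simp: a1_def)
  \<comment> \<open>Almost constancy enters here: halving only \<open>b2\<close> and then applying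
    \<open>k'\<close> gives the value of a flat sector up to the error, hence the lower bound
    \<open>d1\<close>.\<close>
  have "cprod x a2 b1 \<le> 2 * J + E / 2"
    using cprod_halve[of x b2 a2] k' by (simp add: J_def cprod_commute b1_def)
  then have d1: "(dist b1 a2)\<^sup>2 \<ge> 4 * A + B - 4 * J - E"
    by (simp add: cprod_def a2x A_def B_def dist_commute[of a2 b1] power_mult_distrib)
  have ma1: "(dist m a1)\<^sup>2 = l\<^sup>2 * D"
    using dist_left[OF l, of a1 b1] by (simp add: m_def dist_commute D_def power_mult_distrib)
  have h1: "(dist m a2)\<^sup>2 \<ge> (1 - l) * A + l * (dist b1 a2)\<^sup>2 - l * (1 - l) * D"
    using reverse_CN[OF l, of a2 a1 b1] by (simp add: m_def dist_commute D_def A_def a2)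
  have "l * (dist b1 a2)\<^sup>2 \<ge> l * (4 * A + B - 4 * J - E)"
    by (rule mult_left_mono[OF d1 l(1)])
  with h1 have h1': "(dist m a2)\<^sup>2 \<ge> (1 - l) * A + l * (4 * A + B - 4 * J - E) - l * (1 - l) * D"
    by linarith
  \<comment> \<open>Reverse CN at the midpoint \<open>a1\<close> of \<open>x\<close> and
    \<open>a2\<close>, read as an upper bound for \<open>dist m x\<close>.\<close>
  have h2: "2 * (dist m a1)\<^sup>2 \<ge> (dist m x)\<^sup>2 + (dist m a2)\<^sup>2 - 2 * A"
    using reverse_CN[of "1/2" m x a2]
    by (simp add: a1_def[symmetric] A_def a2x power_mult_distrib)
  have "(dist x m)\<^sup>2 \<le> 2 * (l\<^sup>2 * D) + 2 * A - (dist m a2)\<^sup>2"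
    using h2 ma1 by (simp add: dist_commute)
  also have "\<dots> \<le> 2 * (l\<^sup>2 * D) + 2 * A
      - ((1 - l) * A + l * (4 * A + B - 4 * J - E) - l * (1 - l) * D)"
    using h1' by simp
  also have "\<dots> = (1 - l)\<^sup>2 * A + l\<^sup>2 * B + 2 * l * (1 - l) * J + l * E"
    unfolding D by (simp add: power2_eq_square algebra_simps)
  finally have mm: "(dist x m)\<^sup>2 \<le> (1 - l)\<^sup>2 * A + l\<^sup>2 * B + 2 * l * (1 - l) * J + l * E" .
  have "l * E \<le> E" using l \<open>E > 0\<close> by (simp add: mult_left_le_one_le)
  show ?thesis
  proof (rule that[of m "Suc k"], unfold S E_def[symmetric])
    show "(dist x m)\<^sup>2 \<le> (1 - l)\<^sup>2 * cprod x a1 a1 + l\<^sup>2 * cprod x b1 b1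
        + 2 * l * (1 - l) * cprod x a1 b1 + E"
      using mm \<open>l * E \<le> E\<close> by (simp add: A_def B_def J_def)
    fix z
    have "(dist m z)\<^sup>2 \<ge> (1 - l) * (dist a1 z)\<^sup>2 + l * (dist b1 z)\<^sup>2 - l * (1 - l) * D"
      using reverse_CN[OF l, of z a1 b1] by (simp add: m_def dist_commute D_def)
    then have "2 * cprod x m z \<le> (1 - l)\<^sup>2 * A + l\<^sup>2 * B + 2 * l * (1 - l) * J + E + (dist x z)\<^sup>2
        - ((1 - l) * (dist a1 z)\<^sup>2 + l * (dist b1 z)\<^sup>2 - l * (1 - l) * D)"
      using mm \<open>l * E \<le> E\<close> by (simp add: cprod_def)
    also have "\<dots> = 2 * ((1 - l) * cprod x a1 z + l * cprod x b1 z) + E"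
      unfolding D by (simp add: cprod_def A_def B_def power2_eq_square field_simps)
    finally show "cprod x m z \<le> (1 - l) * cprod x a1 z + l * cprod x b1 z + E"
      using \<open>E > 0\<close> by simp
  qed
qed

lemma sum_cprod_Suc:
  "(\<Sum>i<Suc n. \<Sum>j<Suc n. w i * w j * cprod x (f i) (f j)) =
   (\<Sum>i<n. \<Sum>j<n. w i * w j * cprod x (f i) (f j))
   + 2 * w n * (\<Sum>i<n. w i * cprod x (f n) (f i)) + (w n)\<^sup>2 * cprod x (f n) (f n)"
proof -
  have "(\<Sum>i<n. w i * w n * cprod x (f i) (f n)) = w n * (\<Sum>i<n. w i * cprod x (f n) (f i))"
    unfolding sum_distrib_left by (intro sum.cong refl) (simp add: cprod_commute)
  moreover have "(\<Sum>j<n. w n * w j * cprod x (f n) (f j)) = w n * (\<Sum>i<n. w i * cprod x (f n) (f i))"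
    unfolding sum_distrib_left by (intro sum.cong refl) simp
  ultimately show ?thesis
    by (simp add: sum.distrib power2_eq_square)
qed

text \<open>A negative sum \<open>S\<close> survives contraction: after \<open>N\<close> halvings it
  is at most \<open>S / 4 ^ N\<close>. Merging the last two points costs at most
  \<open>E * C\<close>, and since \<open>E\<close> carries the same factor \<open>1 / 4 ^ N\<close>,
  this can be made half of that amount. The sum for one point fewer would then be negative as
  well.\<close>

lemma sum_cprod_nonneg_nat:
  fixes f :: "nat \<Rightarrow> 'a"
  assumes "\<And>i. w i \<ge> 0"
  shows "(\<Sum>i<n. \<Sum>j<n. w i * w j * cprod x (f i) (f j)) \<ge> 0"
  using assms
proof (induction n arbitrary: f w)
  case (Suc n)
  show ?case
  \<comment> \<open>A vanishing last weight just drops the last point. Excluding it makes the merged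
    weight \<open>W\<close> positive, so that the ratio \<open>l\<close> is meaningful.\<close>
  proof (cases "n = 0 \<or> w n = 0")
    case True
    then show ?thesis
      using Suc.IH[of w f] Suc.prems by (auto simp: sum_cprod_Suc)
  next
    case False
    then obtain k where n: "n = Suc k" and "w (Suc k) \<noteq> 0" by (cases n) auto
    then have wk: "w (Suc k) > 0" "w k \<ge> 0" using Suc.prems[of "Suc k"] Suc.prems[of k] by auto
    define W where "W = w k + w (Suc k)"
    define l where "l = w (Suc k) / W"
    have W: "W > 0" "l * W = w (Suc k)" "(1 - l) * W = w k"
      using wk by (auto simp: W_def l_def field_simps)
    have l: "0 \<le> l" "l \<le> 1" using wk by (auto simp: W_def l_def)
    define S where "S = (\<Sum>i<Suc n. \<Sum>j<Suc n. w i * w j * cprod x (f i) (f j))"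
    \<comment> \<open>The coefficient with which the merging error enters the double sum: from the
      products of the merged point with the others, and from its square.\<close>
    define C where "C = 2 * W * (\<Sum>i<k. w i) + W\<^sup>2"
    have "C > 0" unfolding C_def
      using W Suc.prems by (intro add_nonneg_pos) (auto intro!: mult_nonneg_nonneg sum_nonneg)
    have "S \<ge> 0"
    proof (rule ccontr)
      assume "\<not> S \<ge> 0"
      \<comment> \<open>Chosen so that contracted sum plus error equals
        \<open>(S / 2) / 4 ^ N\<close>, which is still negative.\<close>
      define e where "e = - S / (2 * C)"
      have "e > 0" using \<open>\<not> S \<ge> 0\<close> \<open>C > 0\<close> by (simp add: e_def divide_neg_pos)
      obtain N m where
        mm: "(dist x m)\<^sup>2 \<le> (1 - l)\<^sup>2 * cprod x ((halve x ^^ N) (f k)) ((halve x ^^ N) (f k))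
        + l\<^sup>2 * cprod x ((halve x ^^ N) (f (Suc k))) ((halve x ^^ N) (f (Suc k)))
        + 2 * l * (1 - l) * cprod x ((halve x ^^ N) (f k)) ((halve x ^^ N) (f (Suc k))) + e / 4 ^ N"
        and mz: "\<And>z. cprod x m z \<le> (1 - l) * cprod x ((halve x ^^ N) (f k)) z
        + l * cprod x ((halve x ^^ N) (f (Suc k))) z + e / 4 ^ N"
        using merge_two_points[OF l \<open>e > 0\<close>, of x "f k" "f (Suc k)"] by blast
      define h where "h i = (halve x ^^ N) (f i)" for i
      define f' where "f' i = (if i < k then h i else m)" for i
      define w' where "w' i = (if i < k then w i else W)" for i
      define E where "E = e / 4 ^ N"
      note mm = mm[folded h_def E_def] and mz = mz[folded h_def E_def]
      define Q where "Q = (\<Sum>i<k. \<Sum>j<k. w i * w j * cprod x (h i) (h j))"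
      define P1 where "P1 = (\<Sum>i<k. w i * cprod x (h k) (h i))"
      define P2 where "P2 = (\<Sum>i<k. w i * cprod x (h (Suc k)) (h i))"
      define s where "s = (\<Sum>i<k. w i)"
      have Pm: "(\<Sum>i<k. w i * cprod x m (h i)) \<le> (1 - l) * P1 + l * P2 + E * s"
      proof -
        have "(\<Sum>i<k. w i * cprod x m (h i))
            \<le> (\<Sum>i<k. w i * ((1 - l) * cprod x (h k) (h i) + l * cprod x (h (Suc k)) (h i) + E))"
          using mz Suc.prems by (intro sum_mono mult_left_mono) auto
        also have "\<dots> = (1 - l) * P1 + l * P2 + E * s"
          unfolding P1_def P2_def s_def sum_distrib_left sum.distrib[symmetric]
          by (rule sum.cong) (auto simp: algebra_simps)
        finally show ?thesis .
      qed
      have w': "w' i \<ge> 0" for i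
        using Suc.prems W by (simp add: w'_def)
      have "0 \<le> (\<Sum>i<Suc k. \<Sum>j<Suc k. w' i * w' j * cprod x (f' i) (f' j))"
        using Suc.IH[of w' f', OF w'] unfolding n .
      also have "\<dots> = Q + 2 * W * (\<Sum>i<k. w i * cprod x m (h i)) + W\<^sup>2 * (dist x m)\<^sup>2"
      proof -
        have "(\<Sum>i<k. \<Sum>j<k. w' i * w' j * cprod x (f' i) (f' j)) = Q"
          unfolding Q_def by (intro sum.cong refl) (auto simp: w'_def f'_def)
        moreover have "(\<Sum>i<k. w' i * cprod x (f' k) (f' i)) = (\<Sum>i<k. w i * cprod x m (h i))"
          by (intro sum.cong refl) (auto simp: w'_def f'_def)
        moreover have "w' k = W" "f' k = m"
          by (auto simp: w'_def f'_def)
        ultimately show ?thesis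
          by (simp only: sum_cprod_Suc cprod_same)
      qed
      also have "\<dots> \<le> Q + 2 * W * ((1 - l) * P1 + l * P2 + E * s)
          + W\<^sup>2 * ((1 - l)\<^sup>2 * cprod x (h k) (h k) + l\<^sup>2 * cprod x (h (Suc k)) (h (Suc k))
            + 2 * l * (1 - l) * cprod x (h k) (h (Suc k)) + E)"
        using Pm mm W by (intro add_mono mult_left_mono) auto
      also have "\<dots> = Q + 2 * ((1 - l) * W) * P1 + 2 * (l * W) * P2
          + (((1 - l) * W)\<^sup>2 * cprod x (h k) (h k) + (l * W)\<^sup>2 * cprod x (h (Suc k)) (h (Suc k))
            + 2 * (l * W) * ((1 - l) * W) * cprod x (h k) (h (Suc k))) + E * C"
        by (simp add: C_def s_def power2_eq_square algebra_simps)
      also have "\<dots> = (\<Sum>i<Suc n. \<Sum>j<Suc n. w i * w j * cprod x (h i) (h j)) + E * C"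
        unfolding W n sum_cprod_Suc
        by (simp add: P1_def P2_def Q_def cprod_commute[of x "h k" "h (Suc k)"] algebra_simps)
      also have "(\<Sum>i<Suc n. \<Sum>j<Suc n. w i * w j * cprod x (h i) (h j))
          \<le> (\<Sum>i<Suc n. \<Sum>j<Suc n. w i * w j * (cprod x (f i) (f j) / 4 ^ N))"
        unfolding h_def using Suc.prems
        by (intro sum_mono mult_left_mono cprod_funpow_halve) auto
      also have "\<dots> = S / 4 ^ N"
        by (simp add: S_def sum_divide_distrib del: sum.lessThan_Suc)
      also have "S / 4 ^ N + E * C = (S / 2) / 4 ^ N"
        using \<open>C > 0\<close> by (simp add: E_def e_def field_simps)
      also have "\<dots> < 0" using \<open>\<not> S \<ge> 0\<close> by (simp add: divide_neg_pos)
      finally show False by simp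
    qed
    then show ?thesis by (simp add: S_def)
  qed
qed simp

lemma sum_cprod_nonneg:
  fixes f :: "'i \<Rightarrow> 'a"
  assumes "finite S" "\<And>i. i \<in> S \<Longrightarrow> w i \<ge> 0"
  shows "(\<Sum>i\<in>S. \<Sum>j\<in>S. w i * w j * cprod x (f i) (f j)) \<ge> 0"
proof -
  obtain g where g: "bij_betw g {..<card S} S"
    using ex_bij_betw_nat_finite[OF \<open>finite S\<close>] by (auto simp: atLeast0LessThan)
  define v where "v i = (if i < card S then w (g i) else 0)" for i
  have "(\<Sum>i<card S. \<Sum>j<card S. v i * v j * cprod x (f (g i)) (f (g j))) \<ge> 0"
    by (rule sum_cprod_nonneg_nat[where w = v and f = "\<lambda>i. f (g i)"]) (use g assms in \<open>auto simp: v_def bij_betw_def\<close>)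
  also have "(\<Sum>i<card S. \<Sum>j<card S. v i * v j * cprod x (f (g i)) (f (g j)))
      = (\<Sum>i<card S. \<Sum>j<card S. w (g i) * w (g j) * cprod x (f (g i)) (f (g j)))"
    by (simp add: v_def)
  also have "\<dots> = (\<Sum>i\<in>S. \<Sum>j\<in>S. w i * w j * cprod x (f i) (f j))"
    by (simp add: sum.reindex_bij_betw[OF g, symmetric])
  finally show ?thesis .
qed

end

subsection \<open>Minimax for strongly convex functionals\<close>

context cat0_interpolation
begin

text \<open>CN is used twice, from \<open>p\<close> to the geodesic ending at \<open>z\<close> and
  from \<open>z\<close> to the geodesic ending at \<open>y\<close>; the distances from
  \<open>x\<close> cancel.\<close>

lemma contraction_right:
  assumes t: "0 \<le> t" "t \<le> 1"
  shows "dist (c t x y) (c t x z) \<le> t * dist y z"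
proof -
  define p q where "p = c t x y" and "q = c t x z"
  have p: "dist x p = t * dist x y" and q: "dist x q = t * dist x z"
    using dist_left[OF t] by (auto simp: p_def q_def)
  have "(dist p q)\<^sup>2 \<le> (1 - t) * (dist p x)\<^sup>2 + t * (dist p z)\<^sup>2 - t * (1 - t) * (dist x z)\<^sup>2"
    using CN[OF t] by (simp add: q_def)
  moreover have "t * (dist z p)\<^sup>2
      \<le> t * ((1 - t) * (dist z x)\<^sup>2 + t * (dist z y)\<^sup>2 - t * (1 - t) * (dist x y)\<^sup>2)"
    using CN[OF t] t by (intro mult_left_mono) (auto simp: p_def)
  ultimately have "(dist p q)\<^sup>2 \<le> (1 - t) * (t * dist x y)\<^sup>2
      + t * ((1 - t) * (dist x z)\<^sup>2 + t * (dist y z)\<^sup>2 - t * (1 - t) * (dist x y)\<^sup>2)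
      - t * (1 - t) * (dist x z)\<^sup>2"
    by (simp add: dist_commute p[symmetric])
  also have "\<dots> = (t * dist y z)\<^sup>2"
    by (simp add: power2_eq_square algebra_simps)
  finally show ?thesis
    unfolding p_def q_def by (rule power2_le_imp_le) (use t in auto)
qed

lemma contraction_left:
  assumes t: "0 \<le> t" "t \<le> 1"
  shows "dist (c t y x) (c t z x) \<le> (1 - t) * dist y z"
proof -
  define p q where "p = c t y x" and "q = c t z x"
  have p: "dist p x = (1 - t) * dist y x" and q: "dist q x = (1 - t) * dist z x"
    using dist_right[OF t] by (auto simp: p_def q_def)
  have "(dist p q)\<^sup>2 \<le> (1 - t) * (dist p z)\<^sup>2 + t * (dist p x)\<^sup>2 - t * (1 - t) * (dist z x)\<^sup>2"
    using CN[OF t] by (simp add: q_def)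
  moreover have "(1 - t) * (dist z p)\<^sup>2
      \<le> (1 - t) * ((1 - t) * (dist z y)\<^sup>2 + t * (dist z x)\<^sup>2 - t * (1 - t) * (dist y x)\<^sup>2)"
    using CN[OF t] t by (intro mult_left_mono) (auto simp: p_def)
  ultimately have "(dist p q)\<^sup>2 \<le> (1 - t) * ((1 - t) * (dist y z)\<^sup>2 + t * (dist z x)\<^sup>2 - t * (1 - t) * (dist y x)\<^sup>2)
      + t * ((1 - t) * dist y x)\<^sup>2 - t * (1 - t) * (dist z x)\<^sup>2"
    by (simp add: dist_commute[of z] p[symmetric])
  also have "\<dots> = ((1 - t) * dist y z)\<^sup>2"
    by (simp add: power2_eq_square algebra_simps)
  finally show ?thesis
    unfolding p_def q_def by (rule power2_le_imp_le) (use t in auto)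
qed

lemma dist_convex:
  assumes t: "0 \<le> t" "t \<le> 1"
  shows "dist (c t x y) (c t x' y') \<le> (1 - t) * dist x x' + t * dist y y'"
  using contraction_right[OF t, of x y y'] contraction_left[OF t, of x y' x']
    dist_triangle[of "c t x y" "c t x' y'" "c t x y'"] by linarith

lemma dist_c_le:
  assumes t: "0 \<le> t" "t \<le> 1" and "dist x z \<le> r" "dist y z \<le> r"
  shows "dist (c t x y) z \<le> r"
proof -
  have "dist (c t x y) z \<le> (1 - t) * dist x z + t * dist y z"
    using dist_convex[OF t, of x y z z] t by simp
  also have "\<dots> \<le> (1 - t) * r + t * r"
    using assms by (intro add_mono mult_left_mono) auto
  finally show ?thesis by (simp add: algebra_simps)
qed

lemma dist_c_c_le:
  assumes t: "0 \<le> t" "t \<le> 1" and "dist x x' \<le> r" "dist y y' \<le> r"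
  shows "dist (c t x y) (c t x' y') \<le> r"
proof -
  have "dist (c t x y) (c t x' y') \<le> (1 - t) * dist x x' + t * dist y y'"
    by (rule dist_convex[OF t])
  also have "\<dots> \<le> (1 - t) * r + t * r"
    using assms by (intro add_mono mult_left_mono) auto
  finally show ?thesis by (simp add: algebra_simps)
qed

text \<open>The locale relates \<open>c s x y\<close> and \<open>c t x y\<close> only through the
  ends \<open>x\<close> and \<open>y\<close>. CN seen from \<open>c s x y\<close> forces them onto a
  common geodesic, which makes \<open>c\<close> Lipschitz in its ratio.\<close>

lemma dist_c_param:
  assumes "0 \<le> s" "s \<le> t" "t \<le> 1"
  shows "dist (c s x y) (c t x y) = (t - s) * dist x y"
proof (rule antisym)
  have st: "0 \<le> s" "s \<le> 1" "0 \<le> t" "t \<le> 1" using assms by auto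
  show "dist (c s x y) (c t x y) \<ge> (t - s) * dist x y"
    using dist_triangle[of x "c t x y" "c s x y"] dist_left[OF st(1,2), of x y] dist_left[OF st(3,4), of x y]
    by (simp add: algebra_simps)
  define p where "p = c s x y"
  have p: "dist x p = s * dist x y" "dist p y = (1 - s) * dist x y"
    using dist_left[OF st(1,2)] dist_right[OF st(1,2)] by (auto simp: p_def)
  have "(dist p (c t x y))\<^sup>2 \<le> (1 - t) * (dist p x)\<^sup>2 + t * (dist p y)\<^sup>2 - t * (1 - t) * (dist x y)\<^sup>2"
    by (rule CN[OF st(3,4)])
  also have "\<dots> = ((t - s) * dist x y)\<^sup>2"
    unfolding dist_commute[of p x] p by (simp add: power2_eq_square algebra_simps)
  finally show "dist (c s x y) (c t x y) \<le> (t - s) * dist x y"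
    unfolding p_def by (rule power2_le_imp_le) (use assms in auto)
qed

lemma dist_c_abs:
  assumes "0 \<le> s" "s \<le> 1" "0 \<le> t" "t \<le> 1"
  shows "dist (c s x y) (c t x y) = \<bar>s - t\<bar> * dist x y"
  using assms dist_c_param[of s t x y] dist_c_param[of t s x y]
  by (cases "s \<le> t") (auto simp: dist_commute)

text \<open>Normalized so that CN says exactly that squared distances to a point are strongly
  convex; the constant survives convex combinations.\<close>

definition strongly_convex :: "('a \<Rightarrow> real) \<Rightarrow> bool" where
  "strongly_convex \<phi> \<longleftrightarrow> (\<forall>t x y. 0 \<le> t \<longrightarrow> t \<le> 1 \<longrightarrow>
     \<phi> (c t x y) \<le> (1 - t) * \<phi> x + t * \<phi> y - t * (1 - t) * (dist x y)\<^sup>2)"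

end

section \<open>Minimizers and minimax values in complete spaces\<close>

lemma converges_if_dist_square_le:
  fixes X :: "nat \<Rightarrow> 'a::complete_space"
  assumes "\<And>m n. (dist (X m) (X n))\<^sup>2 \<le> e m + e n" and "e \<longlonglongrightarrow> 0"
  obtains l where "X \<longlonglongrightarrow> l"
proof -
  have "Cauchy X"
  proof (rule metric_CauchyI)
    fix r :: real
    assume "r > 0"
    then have "eventually (\<lambda>n. e n < r\<^sup>2 / 2) sequentially"
      using order_tendstoD(2)[OF assms(2), of "r\<^sup>2 / 2"] by simp
    then obtain N where N: "\<And>n. n \<ge> N \<Longrightarrow> e n < r\<^sup>2 / 2"
      by (auto simp: eventually_sequentially)
    have "dist (X m) (X n) < r" if "m \<ge> N" "n \<ge> N" for m n
    proof -
      have "(dist (X m) (X n))\<^sup>2 < r\<^sup>2"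
        using assms(1)[of m n] N[OF that(1)] N[OF that(2)] by linarith
      then show ?thesis by (rule power2_less_imp_less) (use \<open>r > 0\<close> in simp)
    qed
    then show "\<exists>M. \<forall>m\<ge>M. \<forall>n\<ge>M. dist (X m) (X n) < r" by blast
  qed
  then show ?thesis using that by (auto simp: Cauchy_convergent_iff convergent_def)
qed

lemma limit_if_dist_tendsto_0:
  assumes "X \<longlonglongrightarrow> l" and "(\<lambda>n. dist (X n) (Z n)) \<longlonglongrightarrow> 0"
  shows "Z \<longlonglongrightarrow> l"
proof -
  have "(\<lambda>n. dist (X n) l) \<longlonglongrightarrow> 0"
    using assms(1) by (rule tendsto_dist_iff[THEN iffD1])
  from tendsto_add[OF assms(2) this]
  have "(\<lambda>n. dist (X n) (Z n) + dist (X n) l) \<longlonglongrightarrow> 0" by simp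
  moreover have "eventually (\<lambda>n. norm (dist (Z n) l) \<le> dist (X n) (Z n) + dist (X n) l) sequentially"
    by (rule always_eventually) (simp add: dist_triangle3)
  ultimately have "(\<lambda>n. dist (Z n) l) \<longlonglongrightarrow> 0"
    by (rule Lim_null_comparison[rotated])
  then show ?thesis by (rule tendsto_dist_iff[THEN iffD2])
qed

locale complete_cat0 = cat0_interpolation c for c :: "real \<Rightarrow> 'a::complete_space \<Rightarrow> 'a \<Rightarrow> 'a"
begin

lemma strongly_convex_minimizer:
  assumes sc: "strongly_convex \<phi>" and cont: "continuous_on UNIV \<phi>" and bdd: "\<And>y. m \<le> \<phi> y"
  obtains b where "\<And>y. \<phi> b + (dist y b)\<^sup>2 \<le> \<phi> y"
proof -
  define I where "I = (INF y. \<phi> y)"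
  have I: "I \<le> \<phi> y" for y
    unfolding I_def by (rule cINF_lower) (use bdd in \<open>auto intro!: bdd_belowI[of _ m]\<close>)
  define e where "e n = 1 / real (Suc n)" for n
  have e: "e n > 0" for n by (simp add: e_def)
  have e0: "e \<longlonglongrightarrow> 0" unfolding e_def by (rule LIMSEQ_Suc[OF lim_1_over_n])
  have "bdd_below (range \<phi>)" by (rule bdd_belowI[of _ m]) (use bdd in auto)
  then have "\<exists>y. \<phi> y < I + e n" for n
    using cINF_less_iff[of UNIV \<phi> "I + e n"] e[of n] by (simp add: I_def)
  then have "\<forall>n. \<exists>y. \<phi> y < I + e n" by blast
  then obtain X where X: "\<And>n. \<phi> (X n) < I + e n" unfolding choice_iff by blast
  \<comment> \<open>The counterpart of the parallelogram argument: the midpoint of two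
    near-minimizers cannot go below the infimum, so they are close to each other.\<close>
  have "(dist (X m) (X n))\<^sup>2 \<le> 2 * e m + 2 * e n" for m n
  proof -
    have "I \<le> \<phi> (c (1/2) (X m) (X n))" by (rule I)
    also have "\<dots> \<le> (1 - 1/2) * \<phi> (X m) + 1/2 * \<phi> (X n) - 1/2 * (1 - 1/2) * (dist (X m) (X n))\<^sup>2"
      using sc[unfolded strongly_convex_def, rule_format, of "1/2" "X m" "X n"] by simp
    finally show ?thesis using X[of m] X[of n] by simp
  qed
  moreover have "(\<lambda>n. 2 * e n) \<longlonglongrightarrow> 0" using tendsto_mult_right_zero[OF e0] by simp
  ultimately obtain b where b: "X \<longlonglongrightarrow> b"
    using converges_if_dist_square_le[of X "\<lambda>n. 2 * e n"] by blast
  have "(\<lambda>n. \<phi> (X n)) \<longlonglongrightarrow> \<phi> b"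
    using continuous_on_tendsto_compose[OF cont b] by simp
  moreover have "(\<lambda>n. I + e n) \<longlonglongrightarrow> I" using tendsto_add[OF tendsto_const e0, of I] by simp
  ultimately have "\<phi> b \<le> I"
    by (rule LIMSEQ_le) (use X in \<open>auto intro: less_imp_le\<close>)
  \<comment> \<open>Moving a fraction \<open>e n\<close> from \<open>b\<close> towards
    \<open>y\<close> cannot lower the value; dividing by \<open>e n\<close> and letting it tend to 0
    gives quadratic growth with constant 1.\<close>
  have "\<phi> b + (dist y b)\<^sup>2 \<le> \<phi> y" for y
  proof -
    have "\<phi> b + (1 - e n) * (dist y b)\<^sup>2 \<le> \<phi> y" for n
    proof -
      have en: "0 \<le> e n" "e n \<le> 1" by (auto simp: e_def)
      have "\<phi> b \<le> \<phi> (c (e n) b y)" using \<open>\<phi> b \<le> I\<close> I by (meson order_trans)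
      also have "\<dots> \<le> (1 - e n) * \<phi> b + e n * \<phi> y - e n * (1 - e n) * (dist b y)\<^sup>2"
        using sc en unfolding strongly_convex_def by blast
      finally have "e n * (\<phi> b + (1 - e n) * (dist y b)\<^sup>2) \<le> e n * \<phi> y"
        by (simp add: dist_commute algebra_simps)
      then show ?thesis using e[of n] by simp
    qed
    moreover have "(\<lambda>n. \<phi> b + (1 - e n) * (dist y b)\<^sup>2) \<longlonglongrightarrow> \<phi> b + (1 - 0) * (dist y b)\<^sup>2"
      by (intro tendsto_intros e0)
    ultimately show ?thesis using LIMSEQ_le_const2[of _ "\<phi> b + (1 - 0) * (dist y b)\<^sup>2"] by auto
  qed
  then show ?thesis by (rule that)
qed

text \<open>A minimax theorem. Maximizing the minimum over the convex family replaces compactness: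
  minimizers of almost maximal functionals form a Cauchy sequence.\<close>

lemma common_nonpositive_point:
  assumes "K \<noteq> {}"
    and sc: "\<And>\<phi>. \<phi> \<in> K \<Longrightarrow> strongly_convex \<phi>"
    and cont: "\<And>\<phi>. \<phi> \<in> K \<Longrightarrow> continuous_on UNIV \<phi>"
    and bdd: "\<And>\<phi>. \<phi> \<in> K \<Longrightarrow> \<exists>m. \<forall>y. m \<le> \<phi> y"
    and mix: "\<And>\<phi> \<psi> t. \<lbrakk>\<phi> \<in> K; \<psi> \<in> K; 0 \<le> t; t \<le> 1\<rbrakk> \<Longrightarrow> (\<lambda>y. (1 - t) * \<phi> y + t * \<psi> y) \<in> K"
    and neg: "\<And>\<phi>. \<phi> \<in> K \<Longrightarrow> \<exists>y. \<phi> y \<le> 0"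
  obtains y where "\<And>\<phi>. \<phi> \<in> K \<Longrightarrow> \<phi> y \<le> 0"
proof -
  have "\<exists>b. \<forall>y. \<phi> b + (dist y b)\<^sup>2 \<le> \<phi> y" if "\<phi> \<in> K" for \<phi>
    using strongly_convex_minimizer[OF sc[OF that] cont[OF that]] bdd[OF that] by metis
  then obtain b where b: "\<And>\<phi> y. \<phi> \<in> K \<Longrightarrow> \<phi> (b \<phi>) + (dist y (b \<phi>))\<^sup>2 \<le> \<phi> y"
    by metis
  have V0: "\<phi> (b \<phi>) \<le> 0" if "\<phi> \<in> K" for \<phi>
  proof -
    obtain y where "\<phi> y \<le> 0" using neg \<open>\<phi> \<in> K\<close> by blast
    then show ?thesis using b[OF \<open>\<phi> \<in> K\<close>, of y] by (smt (verit) zero_le_power2)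
  qed
  define S where "S = (SUP \<phi>\<in>K. \<phi> (b \<phi>))"
  have bddV: "bdd_above ((\<lambda>\<phi>. \<phi> (b \<phi>)) ` K)" using V0 by (auto intro!: bdd_aboveI[of _ 0])
  have S: "\<phi> (b \<phi>) \<le> S" if "\<phi> \<in> K" for \<phi>
    unfolding S_def by (rule cSUP_upper[OF that bddV])
  have "S \<le> 0" unfolding S_def by (rule cSUP_least) (use V0 \<open>K \<noteq> {}\<close> in auto)
  define e where "e n = 1 / real (Suc n)" for n
  have e: "e n > 0" "e n \<le> 1" for n by (auto simp: e_def)
  have e0: "e \<longlonglongrightarrow> 0" unfolding e_def by (rule LIMSEQ_Suc[OF lim_1_over_n])
  \<comment> \<open>The defect is the square of \<open>e n\<close>, so that it stays negligible
    after division by a mixing weight of size \<open>e n\<close>.\<close>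
  have "\<exists>\<phi>\<in>K. S - (e n)\<^sup>2 < \<phi> (b \<phi>)" for n
    using less_cSUP_iff[OF \<open>K \<noteq> {}\<close> bddV, of "S - (e n)\<^sup>2"] e[of n] by (simp add: S_def[symmetric])
  then obtain F where F: "\<And>n. F n \<in> K" "\<And>n. S - (e n)\<^sup>2 < F n (b (F n))" by metis
  \<comment> \<open>The minimum of a mixture is at most \<open>S\<close>, while at its minimizer
    \<open>q\<close> the first functional has grown quadratically from its own minimum. For almost
    maximal \<open>\<phi>\<close> this keeps \<open>q\<close> close to
    \<open>b \<phi>\<close>.\<close>
  have mix_le: "(1 - t) * (\<phi> (b \<phi>) + (dist q (b \<phi>))\<^sup>2) + t * \<psi> q \<le> S"
    if "\<phi> \<in> K" "\<psi> \<in> K" "0 \<le> t" "t \<le> 1" "q = b (\<lambda>y. (1 - t) * \<phi> y + t * \<psi> y)" for \<phi> \<psi> t q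
  proof -
    have "(1 - t) * (\<phi> (b \<phi>) + (dist q (b \<phi>))\<^sup>2) + t * \<psi> q \<le> (1 - t) * \<phi> q + t * \<psi> q"
      using that b by (intro add_mono mult_left_mono) auto
    also have "\<dots> \<le> S" using S[OF mix[OF that(1-4)]] that(5) by simp
    finally show ?thesis .
  qed
  have "(dist (b (F m)) (b (F n)))\<^sup>2 \<le> 2 * (e m)\<^sup>2 + 2 * (e n)\<^sup>2" for m n
  proof -
    define q where "q = b (\<lambda>y. (1 - 1/2) * F m y + 1/2 * F n y)"
    have "(1 - 1/2) * (F m (b (F m)) + (dist q (b (F m)))\<^sup>2) + 1/2 * F n q \<le> S"
      by (rule mix_le) (use F q_def in auto)
    moreover have "F n (b (F n)) + (dist q (b (F n)))\<^sup>2 \<le> F n q" using b F by blast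
    ultimately have *: "(dist q (b (F m)))\<^sup>2 + (dist q (b (F n)))\<^sup>2 \<le> (e m)\<^sup>2 + (e n)\<^sup>2"
      using F(2)[of m] F(2)[of n] by argo
    have "(dist (b (F m)) (b (F n)))\<^sup>2 \<le> (dist q (b (F m)) + dist q (b (F n)))\<^sup>2"
      by (intro power_mono dist_triangle3) auto
    also have "\<dots> \<le> 2 * ((dist q (b (F m)))\<^sup>2 + (dist q (b (F n)))\<^sup>2)"
      using sum_squares_bound[of "dist q (b (F m))" "dist q (b (F n))"] by (simp add: power2_sum)
    finally show ?thesis using * by simp
  qed
  moreover have "(\<lambda>n. 2 * (e n)\<^sup>2) \<longlonglongrightarrow> 0"
    using tendsto_mult[OF tendsto_const tendsto_power[OF e0, of 2], of 2] by simp
  ultimately obtain p where p: "(\<lambda>n. b (F n)) \<longlonglongrightarrow> p"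
    by (rule converges_if_dist_square_le)
  have "\<psi> p \<le> 0" if "\<psi> \<in> K" for \<psi>
  proof -
    obtain m where m: "\<And>y. m \<le> \<psi> y" using bdd[OF \<open>\<psi> \<in> K\<close>] by blast
    \<comment> \<open>\<open>F (Suc n)\<close> is perturbed slightly towards \<open>\<psi>\<close>.
      The shifted index makes the weight at most 1/2, so \<open>1 - t n\<close> stays away from
      0.\<close>
    define t where "t n = e (Suc n)" for n
    have t: "t n > 0" "t n \<le> 1/2" for n by (auto simp: t_def e_def)
    have t0: "t \<longlonglongrightarrow> 0" unfolding t_def by (rule LIMSEQ_Suc[OF e0])
    define q where "q n = b (\<lambda>y. (1 - t n) * F (Suc n) y + t n * \<psi> y)" for n
    have regroup: "B + C \<le> r" if "X + C \<le> S" "X = P + B" "P \<ge> Q" "Q \<ge> S - r" for X P Q B C r :: real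
      using that by linarith
    have q: "(1 - t n) * (dist (q n) (b (F (Suc n))))\<^sup>2 + t n * \<psi> (q n) \<le> (t n)\<^sup>2" for n
    proof -
      have "(1 - t n) * (F (Suc n) (b (F (Suc n))) + (dist (q n) (b (F (Suc n))))\<^sup>2) + t n * \<psi> (q n) \<le> S"
        by (rule mix_le) (use F t[of n] \<open>\<psi> \<in> K\<close> q_def in auto)
      moreover have "(1 - t n) * F (Suc n) (b (F (Suc n))) \<ge> (1 - t n) * (S - (t n)\<^sup>2)"
        using F(2)[of "Suc n"] t[of n] by (intro mult_left_mono) (auto simp: t_def)
      \<comment> \<open>The sign of \<open>S\<close> matters here: multiplying a nonpositive number
        by \<open>1 - t n\<close> can only raise it.\<close>
      moreover have "(1 - t n) * (S - (t n)\<^sup>2) \<ge> S - (t n)\<^sup>2"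
      proof -
        have "S - (t n)\<^sup>2 \<le> 0" using \<open>S \<le> 0\<close> zero_le_power2[of "t n"] by linarith
        then have "t n * (S - (t n)\<^sup>2) \<le> 0"
          using t[of n] by (intro mult_nonneg_nonpos) auto
        then show ?thesis unfolding left_diff_distrib[of 1] by simp
      qed
      ultimately show ?thesis by (rule regroup[OF _ distrib_left])
    qed
    have d: "(dist (q n) (b (F (Suc n))))\<^sup>2 \<le> 2 * ((t n)\<^sup>2 - t n * m)" for n
    proof -
      have "1/2 * (dist (q n) (b (F (Suc n))))\<^sup>2 \<le> (1 - t n) * (dist (q n) (b (F (Suc n))))\<^sup>2"
        using t[of n] by (intro mult_right_mono) auto
      moreover have "t n * m \<le> t n * \<psi> (q n)"
        using t[of n] m by (intro mult_left_mono) auto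
      ultimately show ?thesis using q[of n] by simp
    qed
    have "(\<lambda>n. 2 * ((t n)\<^sup>2 - t n * m)) \<longlonglongrightarrow> 2 * (0\<^sup>2 - 0 * m)"
      by (intro tendsto_intros t0)
    then have lim0: "(\<lambda>n. 2 * ((t n)\<^sup>2 - t n * m)) \<longlonglongrightarrow> 0" by simp
    have "eventually (\<lambda>n. norm ((dist (q n) (b (F (Suc n))))\<^sup>2) \<le> 2 * ((t n)\<^sup>2 - t n * m)) sequentially"
      using d by (intro always_eventually allI) (simp only: real_norm_def abs_of_nonneg zero_le_power2)
    then have "(\<lambda>n. (dist (q n) (b (F (Suc n))))\<^sup>2) \<longlonglongrightarrow> 0"
      using lim0 by (rule Lim_null_comparison)
    from tendsto_real_sqrt[OF this] have "(\<lambda>n. dist (b (F (Suc n))) (q n)) \<longlonglongrightarrow> 0"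
      by (simp add: dist_commute)
    then have "q \<longlonglongrightarrow> p"
      by (rule limit_if_dist_tendsto_0[OF LIMSEQ_Suc[OF p]])
    from continuous_on_tendsto_compose[OF cont[OF \<open>\<psi> \<in> K\<close>] this]
    have "(\<lambda>n. \<psi> (q n)) \<longlonglongrightarrow> \<psi> p" by simp
    moreover have "\<psi> (q n) \<le> t n" for n
    proof -
      have "0 \<le> (1 - t n) * (dist (q n) (b (F (Suc n))))\<^sup>2" using t[of n] by simp
      then have "t n * \<psi> (q n) \<le> t n * t n" using q[of n] unfolding power2_eq_square[of "t n"] by linarith
      then show ?thesis using t[of n] by simp
    qed
    ultimately show ?thesis by (intro LIMSEQ_le[OF _ t0]) auto
  qed
  then show ?thesis by (rule that)
qed

end

subsection \<open>Lipschitz extension\<close>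

context complete_cat0
begin

lemma strongly_convex_weighted_sum:
  fixes y :: "'i \<Rightarrow> 'a"
  assumes "finite J" "\<And>i. i \<in> J \<Longrightarrow> w i \<ge> 0" "sum w J = 1"
  shows "strongly_convex (\<lambda>p. \<Sum>i\<in>J. w i * ((dist p (y i))\<^sup>2 - R i))"
  unfolding strongly_convex_def
proof (intro allI impI)
  fix t :: real and a b :: 'a
  assume t: "0 \<le> t" "t \<le> 1"
  have "(dist (c t a b) z)\<^sup>2 \<le> (1 - t) * (dist a z)\<^sup>2 + t * (dist b z)\<^sup>2 - t * (1 - t) * (dist a b)\<^sup>2" for z
    using CN[OF t, of z a b] by (simp only: dist_commute[of z])
  then have "(\<Sum>i\<in>J. w i * ((dist (c t a b) (y i))\<^sup>2 - R i))
      \<le> (\<Sum>i\<in>J. w i * ((1 - t) * (dist a (y i))\<^sup>2 + t * (dist b (y i))\<^sup>2 - t * (1 - t) * (dist a b)\<^sup>2 - R i))"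
    using assms by (intro sum_mono mult_left_mono diff_right_mono) auto
  also have "\<dots> = (\<Sum>i\<in>J. (1 - t) * (w i * ((dist a (y i))\<^sup>2 - R i)) + t * (w i * ((dist b (y i))\<^sup>2 - R i))
      - w i * (t * (1 - t) * (dist a b)\<^sup>2))"
    by (intro sum.cong refl) (simp add: algebra_simps)
  also have "\<dots> = (1 - t) * (\<Sum>i\<in>J. w i * ((dist a (y i))\<^sup>2 - R i))
      + t * (\<Sum>i\<in>J. w i * ((dist b (y i))\<^sup>2 - R i)) - sum w J * (t * (1 - t) * (dist a b)\<^sup>2)"
    by (simp only: sum.distrib sum_subtractf sum_distrib_left sum_distrib_right)
  finally show "(\<Sum>i\<in>J. w i * ((dist (c t a b) (y i))\<^sup>2 - R i))
      \<le> (1 - t) * (\<Sum>i\<in>J. w i * ((dist a (y i))\<^sup>2 - R i))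
        + t * (\<Sum>i\<in>J. w i * ((dist b (y i))\<^sup>2 - R i)) - t * (1 - t) * (dist a b)\<^sup>2"
    using assms(3) by simp
qed

lemma weighted_sum_bounded_below:
  fixes y :: "'i \<Rightarrow> 'a"
  assumes "\<And>i. i \<in> J \<Longrightarrow> w i \<ge> 0"
  shows "- (\<Sum>i\<in>J. w i * R i) \<le> (\<Sum>i\<in>J. w i * ((dist p (y i))\<^sup>2 - R i))"
  using assms by (simp add: right_diff_distrib sum_subtractf sum_nonneg)

text \<open>The minimizer \<open>b\<close> is the barycentre of the points \<open>y i\<close>.
  Averaging its quadratic growth over the \<open>y j\<close> is the variance inequality: it gives 2
  * \<open>\<phi> b\<close> \<le> \<open>Q\<close> - 2 * \<open>S\<close>, which is nonpositive by
  \<open>H\<close>.\<close>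

lemma weighted_sum_has_nonpositive_value:
  fixes y :: "'i \<Rightarrow> 'a"
  assumes J: "finite J" and w: "\<And>i. i \<in> J \<Longrightarrow> w i \<ge> 0" "sum w J = 1"
    and H: "(\<Sum>i\<in>J. \<Sum>j\<in>J. w i * w j * (R i + R j - (dist (y i) (y j))\<^sup>2)) \<ge> 0"
  shows "\<exists>p. (\<Sum>i\<in>J. w i * ((dist p (y i))\<^sup>2 - R i)) \<le> 0"
proof -
  define \<phi> :: "'a \<Rightarrow> real" where "\<phi> p = (\<Sum>i\<in>J. w i * ((dist p (y i))\<^sup>2 - R i))" for p
  have "strongly_convex \<phi>"
    unfolding \<phi>_def by (rule strongly_convex_weighted_sum[OF J w])
  moreover have "continuous_on UNIV \<phi>"
    unfolding \<phi>_def by (intro continuous_intros)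
  moreover have "- (\<Sum>i\<in>J. w i * R i) \<le> \<phi> p" for p
    unfolding \<phi>_def by (rule weighted_sum_bounded_below[OF w(1)])
  ultimately obtain b where b: "\<And>y. \<phi> b + (dist y b)\<^sup>2 \<le> \<phi> y"
    by (rule strongly_convex_minimizer) blast
  define E where "E = (\<Sum>i\<in>J. w i * (dist b (y i))\<^sup>2)"
  define S where "S = (\<Sum>i\<in>J. w i * R i)"
  define Q where "Q = (\<Sum>i\<in>J. \<Sum>j\<in>J. w i * w j * (dist (y i) (y j))\<^sup>2)"
  have \<phi>: "\<phi> b = E - S"
    by (simp add: \<phi>_def E_def S_def right_diff_distrib sum_subtractf)
  have const: "(\<Sum>i\<in>J. w i * k) = k" for k
    using w(2) by (simp add: sum_distrib_right[symmetric])
  have "(\<Sum>j\<in>J. w j * (\<phi> b + (dist (y j) b)\<^sup>2)) \<le> (\<Sum>j\<in>J. w j * \<phi> (y j))"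
    using b w by (intro sum_mono mult_left_mono) auto
  moreover have "(\<Sum>j\<in>J. w j * (\<phi> b + (dist (y j) b)\<^sup>2)) = \<phi> b + E"
    by (simp add: distrib_left sum.distrib const E_def dist_commute)
  moreover have "(\<Sum>j\<in>J. w j * \<phi> (y j)) = Q - S"
  proof -
    have "\<phi> (y j) = (\<Sum>i\<in>J. w i * (dist (y j) (y i))\<^sup>2) - S" for j
      by (simp add: \<phi>_def S_def right_diff_distrib sum_subtractf)
    then have "(\<Sum>j\<in>J. w j * \<phi> (y j)) = (\<Sum>j\<in>J. w j * (\<Sum>i\<in>J. w i * (dist (y j) (y i))\<^sup>2)) - S"
      by (simp add: right_diff_distrib sum_subtractf const)
    then show ?thesis by (simp add: Q_def sum_distrib_left mult.assoc)
  qed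
  moreover have "Q \<le> 2 * S"
  proof -
    have "(\<Sum>i\<in>J. \<Sum>j\<in>J. w i * w j * (R i + R j - (dist (y i) (y j))\<^sup>2))
        = (\<Sum>i\<in>J. \<Sum>j\<in>J. w j * (w i * R i)) + (\<Sum>i\<in>J. \<Sum>j\<in>J. w i * (w j * R j)) - Q"
      unfolding Q_def sum.distrib[symmetric] sum_subtractf[symmetric]
      by (intro sum.cong refl) (simp add: algebra_simps)
    also have "\<dots> = 2 * S - Q"
      by (simp add: const sum_distrib_left[symmetric] S_def[symmetric])
    finally show ?thesis using H by simp
  qed
  ultimately have "\<phi> b \<le> 0" using \<phi> by linarith
  then show ?thesis unfolding \<phi>_def by blast
qed

text \<open>By \<open>H\<close> every convex combination of the functions
  \<open>(dist p (y i))\<^sup>2 - R i\<close> of \<open>p\<close> is nonpositive somewhere; the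
  minimax theorem makes one point serve all of them, in particular the individual functions.\<close>

lemma ball_intersection:
  fixes y :: "'i \<Rightarrow> 'a" and R :: "'i \<Rightarrow> real"
  assumes "I \<noteq> {}"
    and H: "\<And>J w. \<lbrakk>finite J; J \<subseteq> I; \<And>i. i \<in> J \<Longrightarrow> w i \<ge> 0\<rbrakk> \<Longrightarrow>
      (\<Sum>i\<in>J. \<Sum>j\<in>J. w i * w j * (R i + R j - (dist (y i) (y j))\<^sup>2)) \<ge> 0"
  obtains p where "\<And>i. i \<in> I \<Longrightarrow> (dist p (y i))\<^sup>2 \<le> R i"
proof -
  define f where "f J w p = (\<Sum>i\<in>J. w i * ((dist p (y i))\<^sup>2 - R i))" for J and w :: "'i \<Rightarrow> real" and p
  \<comment> \<open>Weights vanish off \<open>J\<close>, so that two weighted sums can be rewritten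
    over \<open>J \<union> J'\<close> and mixed there.\<close>
  define W :: "('i set \<times> ('i \<Rightarrow> real)) set" where "W = {(J, w). finite J \<and> J \<subseteq> I \<and> (\<forall>i. w i \<ge> 0) \<and> (\<forall>i. i \<notin> J \<longrightarrow> w i = 0) \<and> sum w J = 1}"
  define K where "K = (\<lambda>(J, w). f J w) ` W"
  have single: "f {i} (\<lambda>j. if j = i then 1 else 0) \<in> K" if "i \<in> I" for i
    unfolding K_def W_def using that by (auto intro!: image_eqI[of _ _ "({i}, \<lambda>j. if j = i then 1 else 0)"] split: if_splits)
  obtain p where p: "\<And>\<phi>. \<phi> \<in> K \<Longrightarrow> \<phi> p \<le> 0"
  proof (rule common_nonpositive_point[of K])
    show "K \<noteq> {}" using \<open>I \<noteq> {}\<close> single by blast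
  next
    fix \<phi> assume "\<phi> \<in> K"
    then obtain J w where \<phi>: "\<phi> = f J w" and Jw: "(J, w) \<in> W" by (auto simp: K_def)
    show "strongly_convex \<phi>"
      unfolding \<phi> f_def using Jw by (intro strongly_convex_weighted_sum) (auto simp: W_def)
    show "continuous_on UNIV \<phi>"
      unfolding \<phi> f_def by (intro continuous_intros)
    show "\<exists>m. \<forall>p. m \<le> \<phi> p"
      unfolding \<phi> f_def using Jw weighted_sum_bounded_below[of J w R _ y] by (auto simp: W_def)
    show "\<exists>p. \<phi> p \<le> 0"
      unfolding \<phi> f_def using Jw
      by (intro weighted_sum_has_nonpositive_value H) (auto simp: W_def)
  next
    fix \<phi> \<psi> and t :: real
    assume "\<phi> \<in> K" "\<psi> \<in> K" and t: "0 \<le> t" "t \<le> 1"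
    then obtain J w J' w' where \<phi>: "\<phi> = f J w" "\<psi> = f J' w'" and Jw: "(J, w) \<in> W" "(J', w') \<in> W"
      by (auto simp: K_def)
    define v where "v i = (1 - t) * w i + t * w' i" for i
    have ext: "(\<Sum>i\<in>J. w i * k i) = (\<Sum>i\<in>J \<union> J'. w i * k i)"
      "(\<Sum>i\<in>J'. w' i * k i) = (\<Sum>i\<in>J \<union> J'. w' i * k i)" for k
      using Jw by (auto simp: W_def intro!: sum.mono_neutral_left)
    have v: "(\<Sum>i\<in>J \<union> J'. v i * k i) = (1 - t) * (\<Sum>i\<in>J. w i * k i) + t * (\<Sum>i\<in>J'. w' i * k i)" for k
      unfolding ext sum_distrib_left sum.distrib[symmetric]
      by (intro sum.cong refl) (simp add: v_def algebra_simps)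
    have "(J \<union> J', v) \<in> W"
      using Jw t v[of "\<lambda>_. 1"] by (auto simp: W_def v_def)
    moreover have "(\<lambda>p. (1 - t) * \<phi> p + t * \<psi> p) = f (J \<union> J') v"
      unfolding \<phi> f_def v by (rule refl)
    ultimately show "(\<lambda>p. (1 - t) * \<phi> p + t * \<psi> p) \<in> K"
      unfolding K_def by (auto intro: image_eqI[of _ _ "(J \<union> J', v)"])
  qed blast
  have "(dist p (y i))\<^sup>2 \<le> R i" if "i \<in> I" for i
    using p[OF single[OF that]] by (simp add: f_def)
  then show ?thesis by (rule that)
qed

end

section \<open>Extension from a subset to the whole space\<close>

locale kirszbraun = X: cbb0_interpolation cX + Y: complete_cat0 cY
  for cX :: "real \<Rightarrow> 'a::metric_space \<Rightarrow> 'a \<Rightarrow> 'a" and cY :: "real \<Rightarrow> 'b::complete_space \<Rightarrow> 'b \<Rightarrow> 'b"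
begin

text \<open>The one-point step of the extension theorem, for maps on (subsets of) two parallel copies of
  the space at distance \<open>sqrt D\<close> inside its product with the line: \<open>F\<close> lives on the first copy and
  \<open>G\<close> is the graph of the partial map on the second one.\<close>

lemma extend_to_point:
  fixes F :: "'a \<Rightarrow> 'b" and z :: 'a
  assumes "lam \<ge> 0" "D \<ge> 0"
    and F: "\<And>x x'. dist (F x) (F x') \<le> lam * dist x x'"
    and G: "\<And>x y x' y'. \<lbrakk>(x, y) \<in> G; (x', y') \<in> G\<rbrakk> \<Longrightarrow> dist y y' \<le> lam * dist x x'"
    and GF: "\<And>x y x'. (x, y) \<in> G \<Longrightarrow> (dist y (F x'))\<^sup>2 \<le> lam\<^sup>2 * (dist x x')\<^sup>2 + D"
  obtains p where "\<And>x y. (x, y) \<in> G \<Longrightarrow> dist p y \<le> lam * dist z x"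
    and "\<And>x. (dist p (F x))\<^sup>2 \<le> lam\<^sup>2 * (dist z x)\<^sup>2 + D"
proof -
  \<comment> \<open>The flag separates the copies: a point of \<open>X\<close> may carry a value
    from \<open>G\<close> (\<open>True\<close>) and the value of \<open>F\<close>
    (\<open>False\<close>) at the same time.\<close>
  define I where "I = {(x, y, True) | x y. (x, y) \<in> G} \<union> {(x, F x, False) | x. True}"
  define val :: "'a \<times> 'b \<times> bool \<Rightarrow> 'b" where "val = (\<lambda>(x, y, b). y)"
  define R :: "'a \<times> 'b \<times> bool \<Rightarrow> real" where "R = (\<lambda>(x, y, b). lam\<^sup>2 * (dist z x)\<^sup>2 + (if b then 0 else D))"
  have sq: "(dist y y')\<^sup>2 \<le> lam\<^sup>2 * (dist x x')\<^sup>2" if "dist y y' \<le> lam * dist x x'" for x x' :: 'a and y y' :: 'b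
    using power_mono[OF that, of 2] by (simp add: power_mult_distrib)
  have key: "R i + R j - (dist (val i) (val j))\<^sup>2 \<ge> 2 * lam\<^sup>2 * cprod z (fst i) (fst j)"
    if "i \<in> I" "j \<in> I" for i j
  proof -
    obtain x y b x' y' b' where ij: "i = (x, y, b)" "j = (x', y', b')" by (metis prod_cases3)
    have "(dist y y')\<^sup>2 \<le> lam\<^sup>2 * (dist x x')\<^sup>2 + (if b then 0 else D) + (if b' then 0 else D)"
    proof (cases b; cases b')
      assume "b" "b'"
      then show ?thesis using that sq[OF G] by (auto simp: I_def ij)
    next
      assume "b" "\<not> b'"
      then show ?thesis using that GF by (auto simp: I_def ij)
    next
      assume "\<not> b" "b'"
      then show ?thesis using that GF[of x' y' x] by (auto simp: I_def ij dist_commute)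
    next
      assume "\<not> b" "\<not> b'"
      then show ?thesis using that sq[OF F, of x x'] \<open>D \<ge> 0\<close> by (auto simp: I_def ij)
    qed
    then show ?thesis by (simp add: ij R_def val_def cprod_def field_simps)
  qed
  have "I \<noteq> {}" by (auto simp: I_def)
  then obtain p where p: "\<And>i. i \<in> I \<Longrightarrow> (dist p (val i))\<^sup>2 \<le> R i"
  proof (rule Y.ball_intersection)
    fix J and w :: "'a \<times> 'b \<times> bool \<Rightarrow> real"
    assume J: "finite J" "J \<subseteq> I" and w: "\<And>i. i \<in> J \<Longrightarrow> w i \<ge> 0"
    have "0 \<le> 2 * lam\<^sup>2 * (\<Sum>i\<in>J. \<Sum>j\<in>J. w i * w j * cprod z (fst i) (fst j))"
      using X.sum_cprod_nonneg[OF J(1) w] by simp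
    also have "\<dots> = (\<Sum>i\<in>J. \<Sum>j\<in>J. w i * w j * (2 * lam\<^sup>2 * cprod z (fst i) (fst j)))"
      by (simp add: sum_distrib_left mult_ac)
    also have "\<dots> \<le> (\<Sum>i\<in>J. \<Sum>j\<in>J. w i * w j * (R i + R j - (dist (val i) (val j))\<^sup>2))"
      by (intro sum_mono mult_left_mono key mult_nonneg_nonneg w) (use J in auto)
    finally show "0 \<le> (\<Sum>i\<in>J. \<Sum>j\<in>J. w i * w j * (R i + R j - (dist (val i) (val j))\<^sup>2))" .
  qed blast
  have "dist p y \<le> lam * dist z x" if "(x, y) \<in> G" for x y
  proof (rule power2_le_imp_le)
    show "(dist p y)\<^sup>2 \<le> (lam * dist z x)\<^sup>2"
      using p[of "(x, y, True)"] that by (auto simp: I_def val_def R_def power_mult_distrib)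
  qed (use \<open>lam \<ge> 0\<close> in simp)
  moreover have "(dist p (F x))\<^sup>2 \<le> lam\<^sup>2 * (dist z x)\<^sup>2 + D" for x
    using p[of "(x, F x, False)"] by (auto simp: I_def val_def R_def)
  ultimately show ?thesis by (rule that)
qed

text \<open>Zorn's lemma for graphs that keep the bound with respect to \<open>F\<close>; taken at
  the point itself this bound is the claimed closeness. Working with relations is enough, since the
  Lipschitz bound at equal arguments makes them single-valued.\<close>

lemma extension_near_map:
  fixes F h :: "'a \<Rightarrow> 'b"
  assumes lam: "lam \<ge> 0" and D: "D \<ge> 0"
    and F: "\<And>x x'. dist (F x) (F x') \<le> lam * dist x x'"
    and h: "\<And>a b. \<lbrakk>a \<in> A; b \<in> A\<rbrakk> \<Longrightarrow> dist (h a) (h b) \<le> lam * dist a b"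
    and hF: "\<And>a x. a \<in> A \<Longrightarrow> (dist (h a) (F x))\<^sup>2 \<le> lam\<^sup>2 * (dist a x)\<^sup>2 + D"
  obtains H where "\<And>a. a \<in> A \<Longrightarrow> H a = h a"
    and "\<And>x x'. dist (H x) (H x') \<le> lam * dist x x'"
    and "\<And>x. (dist (H x) (F x))\<^sup>2 \<le> D"
proof -
  define \<G> where "\<G> = {G. (\<forall>a\<in>A. (a, h a) \<in> G)
    \<and> (\<forall>x y x' y'. (x, y) \<in> G \<longrightarrow> (x', y') \<in> G \<longrightarrow> dist y y' \<le> lam * dist x x')
    \<and> (\<forall>x y x'. (x, y) \<in> G \<longrightarrow> (dist y (F x'))\<^sup>2 \<le> lam\<^sup>2 * (dist x x')\<^sup>2 + D)}"
  have "\<exists>G\<in>\<G>. \<forall>G'\<in>\<G>. G \<subseteq> G' \<longrightarrow> G' = G"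
  proof (rule subset_Zorn_nonempty)
    have "{(a, h a) | a. a \<in> A} \<in> \<G>" using h hF by (auto simp: \<G>_def)
    then show "\<G> \<noteq> {}" by blast
  next
    fix C assume "C \<noteq> {}" and C: "subset.chain \<G> C"
    then have sub: "\<And>G. G \<in> C \<Longrightarrow> G \<in> \<G>" and ch: "\<And>G G'. \<lbrakk>G \<in> C; G' \<in> C\<rbrakk> \<Longrightarrow> G \<subseteq> G' \<or> G' \<subseteq> G"
      by (auto simp: subset.chain_def)
    have lip: "dist y y' \<le> lam * dist x x'" if xy: "(x, y) \<in> \<Union>C" "(x', y') \<in> \<Union>C" for x y x' y'
    proof -
      obtain G where "G \<in> C" "(x, y) \<in> G" "(x', y') \<in> G" using xy ch by blast
      then show ?thesis using sub by (auto simp: \<G>_def)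
    qed
    have on_A: "(a, h a) \<in> \<Union>C" if "a \<in> A" for a
      using that \<open>C \<noteq> {}\<close> sub by (fastforce simp: \<G>_def)
    have near: "(dist y (F x'))\<^sup>2 \<le> lam\<^sup>2 * (dist x x')\<^sup>2 + D" if "(x, y) \<in> \<Union>C" for x y x'
      using that sub by (auto simp: \<G>_def)
    show "\<Union>C \<in> \<G>"
      unfolding \<G>_def by (intro CollectI conjI ballI allI impI) (fact on_A, rule lip, assumption+, rule near)
  qed
  then obtain G where "G \<in> \<G>" and max: "\<And>G'. \<lbrakk>G' \<in> \<G>; G \<subseteq> G'\<rbrakk> \<Longrightarrow> G' = G" by blast
  then have GA: "\<And>a. a \<in> A \<Longrightarrow> (a, h a) \<in> G"
    and G: "\<And>x y x' y'. \<lbrakk>(x, y) \<in> G; (x', y') \<in> G\<rbrakk> \<Longrightarrow> dist y y' \<le> lam * dist x x'"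
    and GF: "\<And>x y x'. (x, y) \<in> G \<Longrightarrow> (dist y (F x'))\<^sup>2 \<le> lam\<^sup>2 * (dist x x')\<^sup>2 + D"
    unfolding \<G>_def by blast+
  have "\<exists>y. (z, y) \<in> G" for z
  proof -
    obtain p where p: "\<And>x y. (x, y) \<in> G \<Longrightarrow> dist p y \<le> lam * dist z x"
      and pF: "\<And>x. (dist p (F x))\<^sup>2 \<le> lam\<^sup>2 * (dist z x)\<^sup>2 + D"
      using extend_to_point[OF lam D F G GF] by blast
    have "insert (z, p) G \<in> \<G>"
      using GA G GF p pF unfolding \<G>_def by (auto simp: dist_commute)
    then show ?thesis using max[of "insert (z, p) G"] by blast
  qed
  then obtain H where H: "\<And>z. (z, H z) \<in> G" by metis
  show ?thesis
  proof (rule that)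
    show "H a = h a" if "a \<in> A" for a using G[OF H GA[OF that], of a] by simp
    show "dist (H x) (H x') \<le> lam * dist x x'" for x x' using G[OF H H] .
    show "(dist (H x) (F x))\<^sup>2 \<le> D" for x using GF[OF H, of x x] by simp
  qed
qed

lemma extension_near_close_map:
  fixes F h :: "'a \<Rightarrow> 'b"
  assumes lam: "lam \<ge> 0" and "e \<ge> 0" "R \<ge> 0"
    and F: "\<And>x x'. dist (F x) (F x') \<le> lam * dist x x'"
    and h: "\<And>a b. \<lbrakk>a \<in> A; b \<in> A\<rbrakk> \<Longrightarrow> dist (h a) (h b) \<le> lam * dist a b"
    and close: "\<And>a. a \<in> A \<Longrightarrow> dist (F a) (h a) \<le> e"
    and R: "\<And>a x. a \<in> A \<Longrightarrow> dist (F x) (h a) \<le> R"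
  obtains H where "\<And>a. a \<in> A \<Longrightarrow> H a = h a"
    and "\<And>x x'. dist (H x) (H x') \<le> lam * dist x x'"
    and "\<And>x. (dist (H x) (F x))\<^sup>2 \<le> 2 * R * e + e\<^sup>2"
proof (rule extension_near_map[OF lam _ F h])
  show "0 \<le> 2 * R * e + e\<^sup>2" using assms(2,3) by simp
  show "(dist (h a) (F x))\<^sup>2 \<le> lam\<^sup>2 * (dist a x)\<^sup>2 + (2 * R * e + e\<^sup>2)" if a: "a \<in> A" for a x
  \<comment> \<open>Up to \<open>R\<close> the square of \<open>lam * dist a x + e\<close> is
    expanded; beyond \<open>R\<close> the values differ by less than \<open>lam * dist a x\<close>
    anyway.\<close>
  proof (cases "lam * dist a x \<le> R")
    case True
    have "dist (h a) (F x) \<le> lam * dist a x + e"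
      using dist_triangle[of "h a" "F x" "F a"] close[OF a] F[of a x] by (simp add: dist_commute)
    then have "(dist (h a) (F x))\<^sup>2 \<le> (lam * dist a x + e)\<^sup>2"
      by (rule power_mono) simp
    also have "\<dots> = lam\<^sup>2 * (dist a x)\<^sup>2 + (2 * (lam * dist a x) * e + e\<^sup>2)"
      by (simp add: power2_eq_square algebra_simps)
    also have "\<dots> \<le> lam\<^sup>2 * (dist a x)\<^sup>2 + (2 * R * e + e\<^sup>2)"
      using True \<open>e \<ge> 0\<close> by (intro add_mono mult_right_mono mult_left_mono) auto
    finally show ?thesis .
  next
    case False
    have "(dist (h a) (F x))\<^sup>2 \<le> (lam * dist a x)\<^sup>2"
      by (rule power_mono) (use False R[OF a, of x] in \<open>auto simp: dist_commute\<close>)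
    moreover have "0 \<le> 2 * R * e + e\<^sup>2" using assms(2,3) by simp
    ultimately show ?thesis by (simp add: power_mult_distrib)
  qed
qed (use that in auto)

end

subsection \<open>Lower semicontinuity of the set of extensions\<close>

lemma Lip_upper_bound:
  assumes "L-lipschitz_on B f"
    and "v \<in> {0} \<union> {dist (f x) (f y) / dist x y | x y. x \<in> B \<and> y \<in> B \<and> x \<noteq> y}"
  shows "v \<le> L"
  using assms lipschitz_on_nonneg[OF assms(1)]
  by (auto simp: divide_le_eq lipschitz_onD)

lemma Lip_nonneg:
  assumes "L-lipschitz_on B f"
  shows "0 \<le> Lip f B"
  unfolding Lip_def using Lip_upper_bound[OF assms] by (intro cSup_upper bdd_aboveI[of _ L]) auto

lemma dist_le_Lip:
  assumes "L-lipschitz_on B f" "x \<in> B" "y \<in> B"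
  shows "dist (f x) (f y) \<le> Lip f B * dist x y"
proof (cases "x = y")
  case False
  then have "dist (f x) (f y) / dist x y \<le> Lip f B"
    unfolding Lip_def using Lip_upper_bound[OF assms(1)] assms(2,3)
    by (intro cSup_upper bdd_aboveI[of _ L]) blast+
  then show ?thesis using False by (simp add: divide_le_eq)
qed simp

lemma Lip_le:
  assumes "0 \<le> L" "\<And>x y. \<lbrakk>x \<in> B; y \<in> B\<rbrakk> \<Longrightarrow> dist (f x) (f y) \<le> L * dist x y"
  shows "Lip f B \<le> L"
  unfolding Lip_def using assms
  by (intro cSup_least Lip_upper_bound[of L B f]) (auto simp: lipschitz_on_def)

text \<open>A pair with nearly optimal quotient keeps most of it under a small change of the map.
  The loss is expressed as a factor \<open>s\<close> because a contraction by \<open>s\<close> is to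
  compensate for it.\<close>

lemma Lip_lower_semicontinuous:
  assumes f: "L-lipschitz_on B f" and "0 \<le> s" "s < 1"
  obtains d where "d > 0"
    and "\<And>h M. \<lbrakk>M-lipschitz_on B h; \<And>a. a \<in> B \<Longrightarrow> dist (f a) (h a) \<le> d\<rbrakk> \<Longrightarrow> s * Lip f B \<le> Lip h B"
proof (cases "Lip f B = 0")
  case True
  then show ?thesis using that[of 1] Lip_nonneg by fastforce
next
  case False
  then have pos: "Lip f B > 0" using Lip_nonneg[OF f] by simp
  then have "s * Lip f B < Lip f B" using \<open>s < 1\<close> by simp
  then obtain v where "v \<in> {0} \<union> {dist (f x) (f y) / dist x y | x y. x \<in> B \<and> y \<in> B \<and> x \<noteq> y}"
    and v: "s * Lip f B < v"
    using less_cSupD[of "{0} \<union> {dist (f x) (f y) / dist x y | x y. x \<in> B \<and> y \<in> B \<and> x \<noteq> y}" "s * Lip f B"]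
    unfolding Lip_def by blast
  moreover have "v > 0" using v pos \<open>0 \<le> s\<close> by (smt (verit) mult_nonneg_nonneg)
  ultimately obtain x y where xy: "x \<in> B" "y \<in> B" "x \<noteq> y" "v = dist (f x) (f y) / dist x y"
    by auto
  \<comment> \<open>Half of the excess, since both end points may move by \<open>d\<close>.\<close>
  define d where "d = (dist (f x) (f y) - s * Lip f B * dist x y) / 2"
  have "d > 0" using v xy by (simp add: d_def less_divide_eq)
  then show ?thesis
  proof (rule that)
    fix h and M :: real
    assume h: "M-lipschitz_on B h" "\<And>a. a \<in> B \<Longrightarrow> dist (f a) (h a) \<le> d"
    have "dist (f x) (f y) \<le> dist (f x) (h x) + dist (h x) (h y) + dist (f y) (h y)"
      using dist_triangle[of "f x" "f y" "h x"] dist_triangle[of "h x" "f y" "h y"]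
      by (simp add: dist_commute)
    also have "\<dots> \<le> d + Lip h B * dist x y + d"
      using h xy dist_le_Lip[OF h(1)] by (intro add_mono) auto
    finally have "s * Lip f B * dist x y \<le> Lip h B * dist x y" by (simp add: d_def)
    then show "s * Lip f B \<le> Lip h B" using xy by simp
  qed
qed

text \<open>Asking only for an inequality of constants makes the set convex and closed under uniform
  limits; agreement on \<open>A\<close> turns it into an equality.\<close>

definition extensions :: "'a::metric_space set \<Rightarrow> ('a \<Rightarrow> 'b::metric_space) \<Rightarrow> ('a \<Rightarrow> 'b) set" where
  "extensions A g = {H. (\<forall>a\<in>A. H a = g a) \<and> (\<forall>x x'. dist (H x) (H x') \<le> Lip g A * dist x x')
     \<and> bounded (range H)}"

lemma extensions_closed:
  assumes "\<And>e. e > 0 \<Longrightarrow> \<exists>K\<in>extensions A g. \<forall>x. dist (f x) (K x) \<le> e"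
  shows "f \<in> extensions A g"
  unfolding extensions_def
proof (intro CollectI conjI ballI allI)
  show "f a = g a" if "a \<in> A" for a
  proof -
    have "dist (f a) (g a) \<le> 0 + e" if "e > 0" for e
    proof -
      obtain K where K: "K \<in> extensions A g" "\<And>x. dist (f x) (K x) \<le> e"
        using assms[OF \<open>e > 0\<close>] by blast
      then have "K a = g a" using \<open>a \<in> A\<close> by (auto simp: extensions_def)
      then show ?thesis using K(2)[of a] by simp
    qed
    then have "dist (f a) (g a) \<le> 0" by (rule field_le_epsilon)
    then show ?thesis by simp
  qed
  show "dist (f x) (f y) \<le> Lip g A * dist x y" for x y
  proof (rule field_le_epsilon)
    fix e :: real assume "e > 0"
    then obtain K where K: "K \<in> extensions A g" "\<And>x. dist (f x) (K x) \<le> e / 2"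
      using assms[of "e / 2"] by auto
    have "dist (f x) (f y) \<le> dist (f x) (K x) + dist (K x) (K y) + dist (f y) (K y)"
      using dist_triangle[of "f x" "f y" "K x"] dist_triangle[of "K x" "f y" "K y"]
      by (simp add: dist_commute)
    also have "\<dots> \<le> e / 2 + Lip g A * dist x y + e / 2"
      using K by (intro add_mono) (auto simp: extensions_def)
    finally show "dist (f x) (f y) \<le> Lip g A * dist x y + e" by simp
  qed
  obtain K where K: "K \<in> extensions A g" "\<And>x. dist (f x) (K x) \<le> 1"
    using assms[of 1] by auto
  then obtain y R where "\<And>x. dist y (K x) \<le> R" by (auto simp: extensions_def bounded_def)
  then have "dist y (f x) \<le> R + 1" for x
    using K(2)[of x] dist_triangle[of y "f x" "K x"] by (smt (verit) dist_commute)
  then show "bounded (range f)" unfolding bounded_def by blast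
qed

lemma (in cat0_interpolation) extensions_convex:
  assumes "H \<in> extensions A g" "K \<in> extensions A g" and t: "0 \<le> t" "t \<le> 1"
  shows "(\<lambda>x. c t (H x) (K x)) \<in> extensions A g"
  unfolding extensions_def
proof (intro CollectI conjI ballI allI)
  show "c t (H a) (K a) = g a" if "a \<in> A" for a
    using assms that by (simp add: extensions_def)
  show "dist (c t (H x) (K x)) (c t (H y) (K y)) \<le> Lip g A * dist x y" for x y
    using assms by (intro dist_c_c_le) (auto simp: extensions_def)
  have "bounded (range H \<union> range K)" using assms by (simp add: extensions_def)
  then obtain y R where R: "\<And>z. z \<in> range H \<union> range K \<Longrightarrow> dist y z \<le> R"
    unfolding bounded_def by blast
  have "dist y (c t (H x) (K x)) \<le> R" for x
    using dist_c_le[OF t, of "H x" y R "K x"] R by (simp add: dist_commute)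
  then show "bounded (range (\<lambda>x. c t (H x) (K x)))" unfolding bounded_def by blast
qed

context kirszbraun
begin

text \<open>The comparison map is the constant \<open>g a\<close>, and a bound for the distance of
  \<open>g a\<close> to the other values serves as both \<open>e\<close> and \<open>R\<close>.
  Closeness to a constant is what keeps the extension bounded.\<close>

lemma extension_exists:
  fixes g :: "'a \<Rightarrow> 'b"
  assumes g: "g \<in> Lmaps A" and "A \<noteq> {}"
  shows "\<exists>H. H \<in> extensions A g"
proof -
  obtain L where L: "L-lipschitz_on A g" using g by (auto simp: Lmaps_def)
  obtain a where "a \<in> A" using \<open>A \<noteq> {}\<close> by blast
  obtain R where R: "\<And>b. b \<in> A \<Longrightarrow> dist (g a) (g b) \<le> R"
    using g bounded_any_center[of "g ` A" "g a"] by (auto simp: Lmaps_def)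
  have "R \<ge> 0" using R[OF \<open>a \<in> A\<close>] by simp
  obtain H where H: "\<And>b. b \<in> A \<Longrightarrow> H b = g b" "\<And>x x'. dist (H x) (H x') \<le> Lip g A * dist x x'"
    "\<And>x. (dist (H x) (g a))\<^sup>2 \<le> 2 * R * R + R\<^sup>2"
  proof (rule extension_near_close_map[of "Lip g A" R R "\<lambda>_. g a" A g])
    show "0 \<le> Lip g A" by (rule Lip_nonneg[OF L])
    then show "dist (g a) (g a) \<le> Lip g A * dist x x'" for x x' :: 'a by simp
  qed (use R \<open>R \<ge> 0\<close> dist_le_Lip[OF L] in auto)
  have "dist (g a) (H x) \<le> sqrt (2 * R * R + R\<^sup>2)" for x
    using H(3) by (simp add: dist_commute real_le_rsqrt)
  then have "bounded (range H)" unfolding bounded_def by blast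
  then have "H \<in> extensions A g" using H by (simp add: extensions_def)
  then show ?thesis by blast
qed

lemma extensions_lower_semicontinuous:
  fixes g :: "'a \<Rightarrow> 'b"
  assumes g: "g \<in> Lmaps A" and "A \<noteq> {}" and F: "F \<in> extensions A g" and "e > 0"
  obtains d where "d > 0"
    and "\<And>h. \<lbrakk>h \<in> Lmaps A; \<And>a. a \<in> A \<Longrightarrow> dist (g a) (h a) \<le> d\<rbrakk> \<Longrightarrow>
      \<exists>H\<in>extensions A h. \<forall>x. dist (F x) (H x) \<le> e"
proof -
  obtain L where L: "L-lipschitz_on A g" using g by (auto simp: Lmaps_def)
  obtain y0 R0 where R0: "R0 > 0" "\<And>x. dist y0 (F x) \<le> R0"
  proof -
    obtain y R where "\<And>x. dist y (F x) \<le> R" using F by (auto simp: extensions_def bounded_def)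
    then show ?thesis using that[of "max 1 R" y] by (simp add: le_max_iff_disj)
  qed
  \<comment> \<open>The contracted map and the values of \<open>g\<close> on \<open>A\<close> stay
    within \<open>R0\<close> of \<open>y0\<close>, and \<open>h\<close> differs from
    \<open>g\<close> on \<open>A\<close> by less than 1.\<close>
  define R where "R = 2 * R0 + 1"
  \<comment> \<open>The last term makes \<open>2 * R * q + q\<^sup>2\<close> at most
    \<open>(e / 2)\<^sup>2\<close>, where \<open>q \<le> 1\<close> gives
    \<open>q\<^sup>2 \<le> q\<close>; the other half of \<open>e\<close> pays for the
    contraction.\<close>
  define q where "q = min 1 (min (e / 2) (e\<^sup>2 / (4 * (2 * R + 1))))"
  have Rpos: "R > 0" using R0 by (simp add: R_def)
  have "q > 0"
    using \<open>e > 0\<close> Rpos by (auto simp: q_def intro!: divide_pos_pos)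
  moreover have "q \<le> 1" "q \<le> e / 2"
    by (simp_all only: q_def min_le_iff_disj order_refl simp_thms)
  ultimately have q: "q > 0" "q \<le> 1" "q \<le> e / 2" by auto
  have qe: "2 * R * q + q\<^sup>2 \<le> (e / 2)\<^sup>2"
  proof -
    have "q\<^sup>2 \<le> q" using q by (simp add: power2_eq_square mult_left_le_one_le)
    then have "2 * R * q + q\<^sup>2 \<le> q * (2 * R + 1)" by (simp add: algebra_simps)
    also have "\<dots> \<le> e\<^sup>2 / (4 * (2 * R + 1)) * (2 * R + 1)"
      using Rpos by (intro mult_right_mono) (auto simp: q_def)
    also have "\<dots> = (e / 2)\<^sup>2" using Rpos by (simp add: power2_eq_square divide_simps)
    finally show ?thesis .
  qed
  \<comment> \<open>The contraction moves values by at most \<open>q / 2\<close>, and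
    \<open>h\<close> may differ from \<open>g\<close> by another \<open>q / 2\<close>: together the
    closeness \<open>q\<close> required on \<open>A\<close>.\<close>
  define s where "s = 1 - min 1 (q / (2 * R0))"
  have s: "0 \<le> s" "s < 1" "s \<le> 1" "(1 - s) * R0 \<le> q / 2"
  proof -
    have "min 1 (q / (2 * R0)) * R0 \<le> q / (2 * R0) * R0"
      using R0 by (intro mult_right_mono) auto
    then show "(1 - s) * R0 \<le> q / 2" using R0 by (simp add: s_def)
  qed (use q R0 in \<open>auto simp: s_def\<close>)
  obtain d1 where d1: "d1 > 0"
    "\<And>h M. \<lbrakk>M-lipschitz_on A h; \<And>a. a \<in> A \<Longrightarrow> dist (g a) (h a) \<le> d1\<rbrakk> \<Longrightarrow> s * Lip g A \<le> Lip (h :: 'a \<Rightarrow> 'b) A"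
    using Lip_lower_semicontinuous[OF L s(1,2)] by metis
  define d where "d = min d1 (q / 2)"
  have "d > 0" using d1 q by (simp add: d_def)
  then show ?thesis
  proof (rule that)
    fix h assume h: "h \<in> Lmaps A" and gh: "\<And>a. a \<in> A \<Longrightarrow> dist (g a) (h a) \<le> d"
    obtain M where M: "M-lipschitz_on A h" using h by (auto simp: Lmaps_def)
    have Lip: "s * Lip g A \<le> Lip h A" by (rule d1(2)[OF M]) (use gh in \<open>auto simp: d_def\<close>)
    define F' where "F' x = cY s y0 (F x)" for x
    have F'F: "dist (F' x) (F x) \<le> q / 2" for x
    proof -
      have "dist (F' x) (F x) = (1 - s) * dist y0 (F x)"
        unfolding F'_def by (rule Y.dist_right[OF s(1,3)])
      also have "\<dots> \<le> (1 - s) * R0" using s R0 by (intro mult_left_mono) auto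
      finally show ?thesis using s by simp
    qed
    have F'0: "dist (F' x) y0 \<le> R0" for x
      unfolding F'_def using R0 by (intro Y.dist_c_le s) (auto simp: dist_commute)
    obtain H where H: "\<And>a. a \<in> A \<Longrightarrow> H a = h a" "\<And>x x'. dist (H x) (H x') \<le> Lip h A * dist x x'"
      "\<And>x. (dist (H x) (F' x))\<^sup>2 \<le> 2 * R * q + q\<^sup>2"
    proof (rule extension_near_close_map[of "Lip h A" q R F' A h])
      show "0 \<le> Lip h A" by (rule Lip_nonneg[OF M])
      show "dist (F' x) (F' x') \<le> Lip h A * dist x x'" for x x'
      proof -
        have "dist (F' x) (F' x') \<le> s * dist (F x) (F x')"
          unfolding F'_def by (rule Y.contraction_right[OF s(1,3)])
        also have "\<dots> \<le> s * (Lip g A * dist x x')"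
          using F s by (intro mult_left_mono) (auto simp: extensions_def)
        also have "\<dots> \<le> Lip h A * dist x x'"
          using mult_right_mono[OF Lip, of "dist x x'"] by (simp add: mult.assoc)
        finally show ?thesis .
      qed
      show "dist (h a) (h b) \<le> Lip h A * dist a b" if "a \<in> A" "b \<in> A" for a b
        by (rule dist_le_Lip[OF M that])
      show "dist (F' a) (h a) \<le> q" if "a \<in> A" for a
        using dist_triangle[of "F' a" "h a" "F a"] F'F[of a] gh[OF that] F that
        by (simp add: extensions_def d_def)
      show "dist (F' x) (h a) \<le> R" if "a \<in> A" for a x
        using dist_triangle[of "F' x" "h a" y0] dist_triangle[of y0 "h a" "g a"]
          F'0[of x] R0(2)[of a] gh[OF that] F that q
        by (simp add: extensions_def d_def R_def)
    qed (use q Rpos in auto)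
    have HF: "dist (F x) (H x) \<le> e" for x
    proof -
      have "dist (H x) (F' x) \<le> e / 2"
        by (rule power2_le_imp_le[OF order_trans[OF H(3) qe]]) (use \<open>e > 0\<close> in simp)
      then show ?thesis
        using dist_triangle[of "F x" "H x" "F' x"] F'F[of x] q by (simp add: dist_commute)
    qed
    have "dist y0 (H x) \<le> R0 + e" for x
      using dist_triangle[of y0 "H x" "F x"] R0(2)[of x] HF[of x] by simp
    then have "bounded (range H)" unfolding bounded_def by blast
    then have "H \<in> extensions A h" using H by (simp add: extensions_def)
    then show "\<exists>H\<in>extensions A h. \<forall>x. dist (F x) (H x) \<le> e" using HF by blast
  qed
qed

end

subsection \<open>Continuous selections\<close>

text \<open>A partition-of-unity substitute for a (pseudo)metric \<open>\<rho>\<close> on a set \<open>M\<close>: the least \<open>\<alpha>\<close> (in a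
  well-order) whose ball contains a point yields, at each scale \<open>(1/2) ^ n\<close>, a discrete family
  \<open>cell n \<alpha>\<close>, and the sets \<open>cell n \<alpha>\<close> cover \<open>M\<close>. Hence \<open>u n\<close> can switch continuously to the value
  attached to the unique nearby cell of level \<open>n\<close>.\<close>

locale locally_selected =
  fixes M :: "'m set" and \<rho> :: "'m \<Rightarrow> 'm \<Rightarrow> real" and rad :: "'m \<Rightarrow> real"
    and less_ind :: "'m \<Rightarrow> 'm \<Rightarrow> bool"
  assumes \<rho>_self: "g \<in> M \<Longrightarrow> \<rho> g g = 0"
    and \<rho>_sym: "\<lbrakk>g \<in> M; h \<in> M\<rbrakk> \<Longrightarrow> \<rho> g h = \<rho> h g"
    and \<rho>_tri: "\<lbrakk>g \<in> M; h \<in> M; k \<in> M\<rbrakk> \<Longrightarrow> \<rho> g k \<le> \<rho> g h + \<rho> h k"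
    and rad_pos: "g \<in> M \<Longrightarrow> rad g > 0"
    and less_wf: "wfp less_ind"
    and less_total: "\<alpha> \<noteq> \<beta> \<Longrightarrow> less_ind \<alpha> \<beta> \<or> less_ind \<beta> \<alpha>"
begin

text \<open>The pieces from Stone's proof that metric spaces are paracompact: depth in the own ball
  and absence from all earlier balls keep different pieces of one level apart.\<close>

definition cell :: "nat \<Rightarrow> 'm \<Rightarrow> 'm set" where
  "cell n \<alpha> = {g \<in> M. \<alpha> \<in> M \<and> \<rho> \<alpha> g \<le> rad \<alpha> - (1/2) ^ n \<and> (\<forall>\<beta>\<in>M. less_ind \<beta> \<alpha> \<longrightarrow> rad \<beta> \<le> \<rho> \<beta> g)}"

text \<open>A Lipschitz cutoff: 1 up to distance \<open>1/8 * (1/2) ^ n\<close> from a cell of level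
  \<open>n\<close>, and 0 from twice that distance on. The inserted 0 also covers levels without
  cells.\<close>

definition u :: "nat \<Rightarrow> 'm \<Rightarrow> real" where
  "u n g = Sup (insert 0 ((\<lambda>s. min 1 (2 - 8 * 2 ^ n * \<rho> g s)) ` (\<Union>\<alpha>. cell n \<alpha>)))"

text \<open>Cells of one level with different indices are at least \<open>(1/2) ^ n\<close> apart,
  so at most one index qualifies. Where none does, the choice is arbitrary and harmless, because
  \<open>u n g\<close> is 0.\<close>

definition ind :: "nat \<Rightarrow> 'm \<Rightarrow> 'm" where
  "ind n g = (SOME \<alpha>. \<exists>s\<in>cell n \<alpha>. \<rho> g s < 1/2 * (1/2) ^ n)"

lemma cell_in: "s \<in> cell n \<alpha> \<Longrightarrow> s \<in> M" "s \<in> cell n \<alpha> \<Longrightarrow> \<alpha> \<in> M"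
  by (auto simp: cell_def)

lemma cells_separated:
  assumes "g \<in> cell n \<alpha>" "h \<in> cell n \<beta>" "\<alpha> \<noteq> \<beta>"
  shows "(1/2) ^ n \<le> \<rho> g h"
proof -
  have *: "(1/2) ^ n \<le> \<rho> g h" if "g \<in> cell n \<alpha>" "h \<in> cell n \<beta>" "less_ind \<alpha> \<beta>" for g h \<alpha> \<beta>
    using that \<rho>_tri[of \<alpha> g h] by (auto simp: cell_def)
  show ?thesis
    using less_total[OF \<open>\<alpha> \<noteq> \<beta>\<close>] *[OF assms(1,2)] *[OF assms(2,1)] \<rho>_sym assms(1,2)
    by (auto simp: cell_in)
qed

lemma cells_cover:
  assumes "g \<in> M"
  obtains n \<alpha> where "g \<in> cell n \<alpha>"
proof -
  define B where "B = {\<alpha> \<in> M. \<rho> \<alpha> g < rad \<alpha>}"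
  have "g \<in> B" using assms by (simp add: B_def \<rho>_self rad_pos)
  then obtain \<alpha> where \<alpha>: "\<alpha> \<in> B" and min: "\<And>\<beta>. less_ind \<beta> \<alpha> \<Longrightarrow> \<beta> \<notin> B"
    using less_wf[unfolded wfp_eq_minimal] by metis
  obtain n where "(1/2 :: real) ^ n < rad \<alpha> - \<rho> \<alpha> g"
    using real_arch_pow_inv[of "rad \<alpha> - \<rho> \<alpha> g" "1/2"] \<alpha> by (auto simp: B_def)
  then have "g \<in> cell n \<alpha>" using \<alpha> min assms by (force simp: cell_def B_def)
  then show ?thesis by (rule that)
qed

lemma u_ge: "s \<in> cell n \<alpha> \<Longrightarrow> min 1 (2 - 8 * 2 ^ n * \<rho> g s) \<le> u n g"
  unfolding u_def by (rule cSup_upper) (auto intro!: bdd_aboveI[of _ 1])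

lemma u_nonneg: "0 \<le> u n g"
  unfolding u_def by (rule cSup_upper) (auto intro!: bdd_aboveI[of _ 1])

lemma u_le:
  assumes "0 \<le> r" "\<And>s \<alpha>. s \<in> cell n \<alpha> \<Longrightarrow> min 1 (2 - 8 * 2 ^ n * \<rho> g s) \<le> r"
  shows "u n g \<le> r"
  unfolding u_def by (rule cSup_least) (use assms in auto)

lemma u_le_1: "u n g \<le> 1"
  by (rule u_le) auto

lemma u_lipschitz:
  assumes "g \<in> M" "h \<in> M"
  shows "\<bar>u n g - u n h\<bar> \<le> 8 * 2 ^ n * \<rho> g h"
proof -
  have "u n g \<le> u n h + 8 * 2 ^ n * \<rho> g h" if gh: "g \<in> M" "h \<in> M" for g h
  proof (rule u_le)
    have "0 \<le> \<rho> g h" using \<rho>_tri[of g h g] \<rho>_self[of g] \<rho>_sym[of g h] gh by simp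
    then have nonneg: "0 \<le> 8 * 2 ^ n * \<rho> g h" by simp
    then show "0 \<le> u n h + 8 * 2 ^ n * \<rho> g h" using u_nonneg[of n h] by linarith
    fix s \<alpha> assume s: "s \<in> cell n \<alpha>"
    have "8 * 2 ^ n * \<rho> h s \<le> 8 * 2 ^ n * (\<rho> g h + \<rho> g s)"
      using \<rho>_tri[of h g s] \<rho>_sym[of g h] gh cell_in[OF s] by (intro mult_left_mono) auto
    then show "min 1 (2 - 8 * 2 ^ n * \<rho> g s) \<le> u n h + 8 * 2 ^ n * \<rho> g h"
      using u_ge[OF s, of h] nonneg unfolding distrib_left by linarith
  qed
  from this[of g h] this[of h g] show ?thesis using assms \<rho>_sym by (simp add: abs_le_iff)
qed

lemma u_eq_1:
  assumes "s \<in> cell n \<alpha>" "\<rho> g s \<le> 1/8 * (1/2) ^ n"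
  shows "u n g = 1"
proof -
  have "8 * 2 ^ n * \<rho> g s \<le> 8 * 2 ^ n * (1/8 * (1/2) ^ n)"
    using assms(2) by (rule mult_left_mono) simp
  then have "8 * 2 ^ n * \<rho> g s \<le> 1" by (simp add: power_divide)
  then show ?thesis using u_ge[OF assms(1), of g] u_le_1[of n g] by simp
qed

lemma u_eq_0:
  assumes "\<And>s \<alpha>. s \<in> cell n \<alpha> \<Longrightarrow> 1/4 * (1/2) ^ n \<le> \<rho> g s"
  shows "u n g = 0"
proof (rule antisym[OF u_le u_nonneg])
  fix s \<alpha> assume "s \<in> cell n \<alpha>"
  then have "8 * 2 ^ n * (1/4 * (1/2) ^ n) \<le> 8 * 2 ^ n * \<rho> g s"
    using assms by (intro mult_left_mono) auto
  moreover have "8 * 2 ^ n * (1/4 * (1/2) ^ n) = (2 :: real)" by (simp add: power_divide)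
  ultimately show "min 1 (2 - 8 * 2 ^ n * \<rho> g s) \<le> 0" by linarith
qed simp

lemma ind_eq:
  assumes "g \<in> M" "s \<in> cell n \<alpha>" "\<rho> g s < 1/2 * (1/2) ^ n"
  shows "ind n g = \<alpha>"
  unfolding ind_def
proof (rule some_equality)
  show "\<exists>s\<in>cell n \<alpha>. \<rho> g s < 1/2 * (1/2) ^ n" using assms by blast
  fix \<beta> assume "\<exists>s\<in>cell n \<beta>. \<rho> g s < 1/2 * (1/2) ^ n"
  then obtain s' where s': "s' \<in> cell n \<beta>" "\<rho> g s' < 1/2 * (1/2) ^ n" by blast
  show "\<beta> = \<alpha>"
  proof (rule ccontr)
    assume "\<beta> \<noteq> \<alpha>"
    then have "(1/2) ^ n \<le> \<rho> s' s" using cells_separated s' assms by blast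
    also have "\<dots> \<le> \<rho> g s' + \<rho> g s"
      using \<rho>_tri[of s' g s] \<rho>_sym[of g s'] cell_in(1)[OF s'(1)] cell_in(1)[OF assms(2)] assms(1) by simp
    finally show False using s' assms by simp
  qed
qed

text \<open>The depth \<open>(1/2) ^ n\<close> of a cell in its ball exceeds the distance
  \<open>1/4 * (1/2) ^ n\<close> at which the cutoff has died out.\<close>

lemma ind_in_ball:
  assumes "g \<in> M" "u n g > 0"
  shows "ind n g \<in> M" "\<rho> (ind n g) g < rad (ind n g)"
proof -
  obtain s \<alpha> where s: "s \<in> cell n \<alpha>" "\<rho> g s < 1/4 * (1/2) ^ n"
    using u_eq_0[of n g] assms(2) by (metis less_irrefl not_le)
  moreover have "(0::real) < (1/2) ^ n" by simp
  ultimately have i: "ind n g = \<alpha>" using ind_eq[OF assms(1) s(1)] by linarith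
  show "ind n g \<in> M" using i cell_in[OF s(1)] by simp
  have "\<rho> \<alpha> g \<le> \<rho> \<alpha> s + \<rho> g s"
    using \<rho>_tri[of \<alpha> s g] \<rho>_sym[of g s] cell_in[OF s(1)] assms by simp
  also have "\<dots> < rad \<alpha>"
  proof -
    have "\<rho> \<alpha> s \<le> rad \<alpha> - (1/2) ^ n" using s(1) by (simp add: cell_def)
    then show ?thesis using s(2) \<open>(0::real) < (1/2) ^ n\<close> by linarith
  qed
  finally show "\<rho> (ind n g) g < rad (ind n g)" using i by simp
qed

end

section \<open>Composing local choices along geodesics\<close>

context cat0_interpolation
begin

definition continuous_family_at ::
  "'m set \<Rightarrow> ('m \<Rightarrow> 'm \<Rightarrow> real) \<Rightarrow> 'm \<Rightarrow> ('m \<Rightarrow> 'x \<Rightarrow> 'a) \<Rightarrow> bool" where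
  "continuous_family_at M \<rho> g \<Phi> \<longleftrightarrow>
     (\<forall>e>0. \<exists>d>0. \<forall>h\<in>M. \<rho> g h < d \<longrightarrow> (\<forall>x. dist (\<Phi> g x) (\<Phi> h x) \<le> e))"

lemma continuous_family_atD:
  assumes "continuous_family_at M \<rho> g \<Phi>" "e > 0"
  obtains d where "d > 0" "\<And>h x. \<lbrakk>h \<in> M; \<rho> g h < d\<rbrakk> \<Longrightarrow> dist (\<Phi> g x) (\<Phi> h x) \<le> e"
  using assms unfolding continuous_family_at_def by blast

lemma continuous_family_at_cong:
  assumes "continuous_family_at M \<rho> g \<Phi>" "g \<in> M" "\<rho> g g < d" "d > 0"
    and eq: "\<And>h. \<lbrakk>h \<in> M; \<rho> g h < d\<rbrakk> \<Longrightarrow> \<Psi> h = \<Phi> h"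
  shows "continuous_family_at M \<rho> g \<Psi>"
  unfolding continuous_family_at_def
proof (intro allI impI)
  fix e :: real assume "e > 0"
  with assms(1) obtain d' where "d' > 0" "\<And>h x. \<lbrakk>h \<in> M; \<rho> g h < d'\<rbrakk> \<Longrightarrow> dist (\<Phi> g x) (\<Phi> h x) \<le> e"
    by (rule continuous_family_atD) blast
  then show "\<exists>d>0. \<forall>h\<in>M. \<rho> g h < d \<longrightarrow> (\<forall>x. dist (\<Psi> g x) (\<Psi> h x) \<le> e)"
    using eq eq[of g] assms(2-4) by (intro exI[of _ "min d d'"]) auto
qed

end

locale selection_setup = cat0_interpolation c + locally_selected M \<rho> rad less_ind
  for c :: "real \<Rightarrow> 'a::metric_space \<Rightarrow> 'a \<Rightarrow> 'a"
    and M :: "'m set" and \<rho> rad less_ind +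
  fixes Q :: "'m \<Rightarrow> ('x \<Rightarrow> 'a) set" and H :: "'m \<Rightarrow> 'x \<Rightarrow> 'a"
  assumes Q_bounded: "\<lbrakk>g \<in> M; f \<in> Q g\<rbrakk> \<Longrightarrow> bounded (range f)"
    and Q_convex: "\<lbrakk>g \<in> M; f \<in> Q g; f' \<in> Q g; 0 \<le> t; t \<le> 1\<rbrakk> \<Longrightarrow> (\<lambda>x. c t (f x) (f' x)) \<in> Q g"
    and H_in: "\<lbrakk>g \<in> M; h \<in> M; \<rho> g h < rad g\<rbrakk> \<Longrightarrow> H g \<in> Q h"
begin

definition step :: "'m \<Rightarrow> nat \<Rightarrow> ('x \<Rightarrow> 'a) \<Rightarrow> 'x \<Rightarrow> 'a" where
  "step g n f x = c (u n g) (f x) (H (ind n g) x)"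

lemma step_0: "u n g = 0 \<Longrightarrow> step g n f = f"
  by (simp add: step_def fun_eq_iff)

lemma step_1: "u n g = 1 \<Longrightarrow> step g n f = H (ind n g)"
  by (simp add: step_def fun_eq_iff)

lemma step_in:
  assumes "g \<in> M" "f \<in> Q g"
  shows "step g n f \<in> Q g"
proof (cases "u n g = 0")
  case False
  then have pos: "u n g > 0" using u_nonneg[of n g] by simp
  have "H (ind n g) \<in> Q g"
    using H_in ind_in_ball[OF assms(1) pos] assms(1) by blast
  then have "(\<lambda>x. c (u n g) (f x) (H (ind n g) x)) \<in> Q g"
    by (rule Q_convex[OF assms _ u_nonneg u_le_1])
  then show ?thesis unfolding step_def .
qed (use assms step_0 in simp)

lemma foldr_step_in:
  assumes "g \<in> M" "f \<in> Q g"
  shows "foldr (step g) ns f \<in> Q g"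
  by (induction ns) (auto intro: assms step_in)

text \<open>Near a cell the target \<open>ind n\<close> is locally constant and only the ratio
  \<open>u n\<close> and \<open>\<Phi>\<close> vary; away from all cells \<open>u n\<close> vanishes
  locally and nothing moves. Boundedness turns a small change of the ratio into a displacement that
  is small uniformly in \<open>x\<close>.\<close>

lemma step_continuous:
  assumes g: "g \<in> M" and \<Phi>: "continuous_family_at M \<rho> g \<Phi>" and bdd: "bounded (range (\<Phi> g))"
  shows "continuous_family_at M \<rho> g (\<lambda>h. step h n (\<Phi> h))"
proof (cases "\<exists>\<alpha>. \<exists>s\<in>cell n \<alpha>. \<rho> g s < 1/2 * (1/2) ^ n")
  case True
  then obtain \<alpha> s where s: "s \<in> cell n \<alpha>" "\<rho> g s < 1/2 * (1/2) ^ n" by blast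
  have \<alpha>: "\<alpha> \<in> M" using cell_in[OF s(1)] by simp
  have ind: "ind n h = \<alpha>" if "h \<in> M" "\<rho> g h < 1/2 * (1/2) ^ n - \<rho> g s" for h
    using ind_eq[OF that(1) s(1)] \<rho>_tri[of h g s] \<rho>_sym[of g h] that cell_in[OF s(1)] g by simp
  have "bounded (range (\<Phi> g) \<union> range (H \<alpha>))"
    using bdd Q_bounded[OF \<alpha> H_in[OF \<alpha> \<alpha>]] \<rho>_self[OF \<alpha>] rad_pos[OF \<alpha>] by simp
  then obtain B where B: "B > 0" "\<And>x. dist (\<Phi> g x) (H \<alpha> x) \<le> B"
    using bounded_two_points[of "range (\<Phi> g) \<union> range (H \<alpha>)"]
    by (metis UnI1 UnI2 rangeI less_max_iff_disj zero_less_one max.coboundedI2)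
  show ?thesis
    unfolding continuous_family_at_def
  proof (intro allI impI)
    fix e :: real assume "e > 0"
    then obtain d where d: "d > 0" "\<And>h x. \<lbrakk>h \<in> M; \<rho> g h < d\<rbrakk> \<Longrightarrow> dist (\<Phi> g x) (\<Phi> h x) \<le> e / 2"
      using continuous_family_atD[OF \<Phi>, of "e / 2"] by (metis half_gt_zero)
    \<comment> \<open>Within distance \<open>k\<close> the ratio changes by at most
      \<open>e / (2 * B)\<close>, which displaces values by at most \<open>e / 2\<close>.\<close>
    define k where "k = e / (2 * B * (8 * 2 ^ n))"
    have "k > 0" using \<open>e > 0\<close> B by (simp add: k_def)
    define d' where "d' = min d (min k (1/2 * (1/2) ^ n - \<rho> g s))"
    have "d' > 0" using d \<open>k > 0\<close> s by (simp add: d'_def)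
    moreover have "dist (step g n (\<Phi> g) x) (step h n (\<Phi> h) x) \<le> e" if h: "h \<in> M" "\<rho> g h < d'" for h x
    proof -
      have "ind n g = \<alpha>" "ind n h = \<alpha>"
        using ind[OF g] ind[OF h(1)] h(2) s \<rho>_self[OF g] by (auto simp: d'_def)
      then have "dist (step g n (\<Phi> g) x) (step h n (\<Phi> h) x)
          \<le> dist (c (u n g) (\<Phi> g x) (H \<alpha> x)) (c (u n h) (\<Phi> g x) (H \<alpha> x))
            + dist (c (u n h) (\<Phi> g x) (H \<alpha> x)) (c (u n h) (\<Phi> h x) (H \<alpha> x))"
        unfolding step_def by (simp add: dist_triangle)
      also have "dist (c (u n g) (\<Phi> g x) (H \<alpha> x)) (c (u n h) (\<Phi> g x) (H \<alpha> x))
          = \<bar>u n g - u n h\<bar> * dist (\<Phi> g x) (H \<alpha> x)"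
        by (rule dist_c_abs[OF u_nonneg u_le_1 u_nonneg u_le_1])
      also have "\<dots> \<le> (8 * 2 ^ n * k) * B"
      proof (rule mult_mono)
        have "8 * 2 ^ n * \<rho> g h \<le> 8 * 2 ^ n * k"
          using h by (intro mult_left_mono) (auto simp: d'_def)
        then show "\<bar>u n g - u n h\<bar> \<le> 8 * 2 ^ n * k"
          using u_lipschitz[OF g h(1), of n] by linarith
      qed (use B \<open>k > 0\<close> in auto)
      also have "\<dots> = e / 2" using B by (simp add: k_def)
      also have "dist (c (u n h) (\<Phi> g x) (H \<alpha> x)) (c (u n h) (\<Phi> h x) (H \<alpha> x)) \<le> e / 2"
        using d(2)[OF h(1), of x] h(2) \<open>e > 0\<close>
        by (intro dist_c_c_le[OF u_nonneg u_le_1]) (auto simp: d'_def)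
      finally show ?thesis by simp
    qed
    ultimately show "\<exists>d>0. \<forall>h\<in>M. \<rho> g h < d \<longrightarrow> (\<forall>x. dist (step g n (\<Phi> g) x) (step h n (\<Phi> h) x) \<le> e)"
      by blast
  qed
next
  case False
  have "u n h = 0" if h: "h \<in> M" "\<rho> g h < 1/4 * (1/2) ^ n" for h
  proof (rule u_eq_0)
    fix s \<alpha> assume s: "s \<in> cell n \<alpha>"
    then have "1/2 * (1/2) ^ n \<le> \<rho> g s" using False by (metis not_le)
    also have "\<dots> \<le> \<rho> g h + \<rho> h s" using \<rho>_tri[OF g h(1) cell_in(1)[OF s]] .
    finally show "1/4 * (1/2) ^ n \<le> \<rho> h s" using h(2) by linarith
  qed
  then have eq: "step h n (\<Phi> h) = \<Phi> h" if "h \<in> M" "\<rho> g h < 1/4 * (1/2) ^ n" for h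
    using that step_0 by blast
  show ?thesis
    by (rule continuous_family_at_cong[OF \<Phi> g, where d = "1/4 * (1/2) ^ n"]) (simp_all add: eq \<rho>_self[OF g])
qed

lemma foldr_step_continuous:
  assumes g: "g \<in> M" and f: "f \<in> Q g"
  shows "continuous_family_at M \<rho> g (\<lambda>h. foldr (step h) ns f)"
proof (induction ns)
  case Nil
  then show ?case by (auto simp: continuous_family_at_def intro: exI[of _ 1])
next
  case (Cons n ns)
  have "bounded (range (foldr (step g) ns f))"
    by (rule Q_bounded[OF g foldr_step_in[OF g f]])
  from step_continuous[OF g Cons this] show ?case by simp
qed

definition level :: "'m \<Rightarrow> nat" where
  "level g = (LEAST n. u n g = 1)"

text \<open>\<open>foldr\<close> applies the highest level first, so lower levels have the last
  word. The composition over infinitely many levels breaks off at the first one with ratio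
  1.\<close>

definition selection :: "'m \<Rightarrow> 'x \<Rightarrow> 'a" where
  "selection g = foldr (step g) [0..<level g] (H (ind (level g) g))"

text \<open>A step with ratio 1 forgets its input, so the fold may start at any level where the
  cutoff is 1. Jumps of \<open>level\<close> thereby become harmless: one fixed \<open>n\<close>
  serves a whole neighbourhood.\<close>

lemma selection_eq:
  assumes "u n g = 1"
  shows "selection g = foldr (step g) [0..<n] (H (ind n g))"
proof -
  have le: "level g \<le> n" and u: "u (level g) g = 1"
    using assms unfolding level_def by (auto intro: Least_le LeastI)
  show ?thesis
  proof (cases "level g = n")
    case True
    then show ?thesis by (simp add: selection_def)
  next
    case False
    then have "[0..<n] = [0..<level g] @ level g # [Suc (level g)..<n]"
      using le upt_add_eq_append[of 0 "level g" "n - level g"] by (simp add: upt_conv_Cons)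
    then show ?thesis by (simp add: selection_def step_1[OF u])
  qed
qed

lemma selection_in:
  assumes "g \<in> M"
  shows "selection g \<in> Q g"
proof -
  obtain n \<alpha> where "g \<in> cell n \<alpha>" using cells_cover[OF assms] .
  then have u: "u n g = 1" by (rule u_eq_1) (simp add: \<rho>_self[OF assms])
  have "H (ind n g) \<in> Q g"
    using H_in ind_in_ball[OF assms, of n] u assms by simp
  then show ?thesis unfolding selection_eq[OF u] by (rule foldr_step_in[OF assms])
qed

lemma selection_continuous:
  assumes g: "g \<in> M"
  shows "continuous_family_at M \<rho> g selection"
proof -
  obtain n \<alpha> where cell: "g \<in> cell n \<alpha>" using cells_cover[OF g] .
  define d :: real where "d = 1/8 * (1/2) ^ n"
  have "d > 0" by (simp add: d_def)
  have near: "u n h = 1" "ind n h = \<alpha>" if "h \<in> M" "\<rho> g h < d" for h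
  proof -
    have "(0::real) < (1/2) ^ n" by simp
    then have "\<rho> h g \<le> 1/8 * (1/2) ^ n" "\<rho> h g < 1/2 * (1/2) ^ n"
      using that \<rho>_sym[OF g that(1)] unfolding d_def by linarith+
    then show "u n h = 1" "ind n h = \<alpha>" using u_eq_1[OF cell] ind_eq[OF that(1) cell] by auto
  qed
  have "\<rho> g g < d" using \<open>d > 0\<close> \<rho>_self[OF g] by simp
  have "H \<alpha> \<in> Q g"
    using H_in ind_in_ball[OF g, of n] near[OF g \<open>\<rho> g g < d\<close>] g by simp
  then have "continuous_family_at M \<rho> g (\<lambda>h. foldr (step h) [0..<n] (H \<alpha>))"
    by (rule foldr_step_continuous[OF g])
  then show ?thesis
    using g \<open>\<rho> g g < d\<close> \<open>d > 0\<close>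
    by (rule continuous_family_at_cong) (simp add: selection_eq[OF near(1)] near(2))
qed

end

text \<open>\<open>loc\<close> is stronger than lower semicontinuity: the same \<open>f\<close> has
  to be admissible for all nearby \<open>h\<close>. Optimal extensions themselves cannot offer this,
  since an extension of \<open>g\<close> does not extend an \<open>h\<close> that differs from
  \<open>g\<close> on \<open>A\<close>; their uniform neighbourhoods can.\<close>

lemma (in cat0_interpolation) continuous_selection:
  fixes M :: "'m set" and Q :: "'m \<Rightarrow> ('x \<Rightarrow> 'a) set"
  assumes \<rho>: "\<And>g. g \<in> M \<Longrightarrow> \<rho> g g = 0" "\<And>g h. \<lbrakk>g \<in> M; h \<in> M\<rbrakk> \<Longrightarrow> \<rho> g h = \<rho> h g"
      "\<And>g h k. \<lbrakk>g \<in> M; h \<in> M; k \<in> M\<rbrakk> \<Longrightarrow> \<rho> g k \<le> \<rho> g h + \<rho> h k"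
    and Q: "\<And>g f. \<lbrakk>g \<in> M; f \<in> Q g\<rbrakk> \<Longrightarrow> bounded (range f)"
      "\<And>g f f' t. \<lbrakk>g \<in> M; f \<in> Q g; f' \<in> Q g; 0 \<le> t; t \<le> 1\<rbrakk> \<Longrightarrow> (\<lambda>x. c t (f x) (f' x)) \<in> Q g"
    and loc: "\<And>g. g \<in> M \<Longrightarrow> \<exists>f. \<exists>r>0. \<forall>h\<in>M. \<rho> g h < r \<longrightarrow> f \<in> Q h"
  obtains \<phi> where "\<And>g. g \<in> M \<Longrightarrow> \<phi> g \<in> Q g"
    and "\<And>g. g \<in> M \<Longrightarrow> continuous_family_at M \<rho> g \<phi>"
proof -
  have "\<forall>g\<in>M. \<exists>f r. r > 0 \<and> (\<forall>h\<in>M. \<rho> g h < r \<longrightarrow> f \<in> Q h)" using loc by blast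
  then obtain H rad where H: "\<And>g. g \<in> M \<Longrightarrow> rad g > 0"
    "\<And>g h. \<lbrakk>g \<in> M; h \<in> M; \<rho> g h < rad g\<rbrakk> \<Longrightarrow> H g \<in> Q h"
    unfolding bchoice_iff by blast
  obtain r :: "'m rel" where r: "well_order_on UNIV r" using well_order_on by blast
  define less_ind where "less_ind a b \<longleftrightarrow> (a, b) \<in> r - Id" for a b
  have "wfp less_ind"
  proof -
    have "{(a, b). less_ind a b} = r - Id" by (auto simp: less_ind_def)
    then show ?thesis using r by (simp add: well_order_on_def wfp_def)
  qed
  moreover have "less_ind a b \<or> less_ind b a" if "a \<noteq> b" for a b
    using r that unfolding less_ind_def well_order_on_def linear_order_on_def total_on_def by auto
  ultimately interpret selection_setup c M \<rho> rad less_ind Q H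
    by unfold_locales (use \<rho> Q H in auto)
  show ?thesis using that selection_in selection_continuous by blast
qed

subsection \<open>Continuous extension operators\<close>

lemma geometric_limit:
  fixes X :: "nat \<Rightarrow> 'a::complete_space"
  assumes "\<And>n. dist (X (Suc n)) (X n) \<le> 2 * (1/2) ^ n"
  obtains l where "\<And>n. dist (X n) l \<le> 4 * (1/2) ^ n"
proof -
  have *: "dist (X (n + k)) (X n) \<le> 4 * (1/2) ^ n - 4 * (1/2) ^ (n + k)" for n k
  proof (induction k)
    case (Suc k)
    then show ?case
      using dist_triangle[of "X (n + Suc k)" "X n" "X (n + k)"] assms[of "n + k"] by simp
  qed simp
  have le: "dist (X m) (X n) \<le> 4 * (1/2) ^ n" if "n \<le> m" for m n
  proof -
    have "dist (X m) (X n) \<le> 4 * (1/2) ^ n - 4 * (1/2) ^ m"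
      using *[of n "m - n"] that by simp
    moreover have "(0::real) \<le> (1/2) ^ m" by simp
    ultimately show ?thesis by linarith
  qed
  have "Cauchy X"
  proof (rule metric_CauchyI)
    fix e :: real assume "e > 0"
    then obtain N where N: "(1/2::real) ^ N < e / 8" using real_arch_pow_inv[of "e / 8" "1/2"] by auto
    have "dist (X m) (X n) < e" if "m \<ge> N" "n \<ge> N" for m n
      using dist_triangle2[of "X m" "X n" "X N"] le[OF that(1)] le[OF that(2)] N by linarith
    then show "\<exists>N. \<forall>m\<ge>N. \<forall>n\<ge>N. dist (X m) (X n) < e" by blast
  qed
  then obtain l where l: "X \<longlonglongrightarrow> l" by (auto simp: Cauchy_convergent_iff convergent_def)
  have "dist (X n) l \<le> 4 * (1/2) ^ n" for n
  proof (rule LIMSEQ_le_const2)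
    show "(\<lambda>m. dist (X n) (X m)) \<longlonglongrightarrow> dist (X n) l" by (intro tendsto_intros l)
    show "\<exists>N. \<forall>m\<ge>N. dist (X n) (X m) \<le> 4 * (1/2) ^ n" using le by (subst dist_commute) blast
  qed
  then show ?thesis by (rule that)
qed

section \<open>The supremum distance\<close>

lemma sup_dist_bdd_above:
  assumes "bounded (f ` A)" "bounded (g ` A)"
  shows "bdd_above ((\<lambda>x. dist (f x) (g x)) ` A)"
proof -
  have "bounded (f ` A \<union> g ` A)" using assms by simp
  then obtain B where "\<And>x y. \<lbrakk>x \<in> f ` A \<union> g ` A; y \<in> f ` A \<union> g ` A\<rbrakk> \<Longrightarrow> dist x y \<le> B"
    unfolding bounded_two_points by blast
  then show ?thesis by (intro bdd_aboveI[of _ B]) auto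
qed

lemma dist_le_sup_dist:
  assumes "f \<in> Lmaps A" "g \<in> Lmaps A" "a \<in> A"
  shows "dist (f a) (g a) \<le> sup_dist A f g"
  unfolding sup_dist_def
  using assms by (intro cSUP_upper sup_dist_bdd_above) (auto simp: Lmaps_def)

lemma sup_dist_le:
  assumes "A \<noteq> {}" "\<And>a. a \<in> A \<Longrightarrow> dist (f a) (g a) \<le> r"
  shows "sup_dist A f g \<le> r"
  unfolding sup_dist_def using assms by (rule cSUP_least)

lemma sup_dist_self: "A \<noteq> {} \<Longrightarrow> sup_dist A f f = 0"
  by (simp add: sup_dist_def)

lemma sup_dist_commute: "sup_dist A f g = sup_dist A g f"
  by (simp add: sup_dist_def dist_commute)

lemma sup_dist_triangle:
  assumes "A \<noteq> {}" "f \<in> Lmaps A" "g \<in> Lmaps A" "h \<in> Lmaps A"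
  shows "sup_dist A f h \<le> sup_dist A f g + sup_dist A g h"
proof (rule sup_dist_le[OF assms(1)])
  fix a assume "a \<in> A"
  then show "dist (f a) (h a) \<le> sup_dist A f g + sup_dist A g h"
    using dist_triangle[of "f a" "h a" "g a"] dist_le_sup_dist[of f A g a] dist_le_sup_dist[of g A h a]
      assms by linarith
qed

lemma bounded_near_bounded:
  assumes "bounded (range K)" "\<And>x. dist (f x) (K x) \<le> e"
  shows "bounded (range f)"
proof -
  obtain y R where R: "\<And>x. dist y (K x) \<le> R" using assms(1) by (auto simp: bounded_def)
  have "dist y (f x) \<le> R + e" for x
    using dist_triangle2[of y "f x" "K x"] R[of x] assms(2)[of x] by linarith
  then show ?thesis unfolding bounded_def by blast
qed

lemma extensions_Lmaps:
  assumes "g \<in> Lmaps A" "H \<in> extensions A g"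
  shows "H \<in> Lmaps UNIV" and "Lip H UNIV = Lip g A" and "\<And>a. a \<in> A \<Longrightarrow> H a = g a"
proof -
  obtain L where L: "L-lipschitz_on A g" using assms by (auto simp: Lmaps_def)
  have H: "\<And>x x'. dist (H x) (H x') \<le> Lip g A * dist x x'" "bounded (range H)"
    using assms(2) by (auto simp: extensions_def)
  show eq: "H a = g a" if "a \<in> A" for a using assms(2) that by (simp add: extensions_def)
  have lip: "(Lip g A)-lipschitz_on UNIV H"
    using H Lip_nonneg[OF L] by (auto simp: lipschitz_on_def)
  then show "H \<in> Lmaps UNIV" using H by (auto simp: Lmaps_def)
  show "Lip H UNIV = Lip g A"
  proof (rule antisym)
    show "Lip H UNIV \<le> Lip g A" by (rule Lip_le) (use H Lip_nonneg[OF L] in auto)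
    show "Lip g A \<le> Lip H UNIV"
    proof (rule Lip_le)
      show "0 \<le> Lip H UNIV" by (rule Lip_nonneg[OF lip])
      show "dist (g x) (g y) \<le> Lip H UNIV * dist x y" if "x \<in> A" "y \<in> A" for x y
        using dist_le_Lip[OF lip, of x y] eq that by simp
    qed
  qed
qed

section \<open>From approximate to exact extension operators\<close>

context kirszbraun
begin

abbreviation continuous_operator :: "'a set \<Rightarrow> (('a \<Rightarrow> 'b) \<Rightarrow> 'a \<Rightarrow> 'b) \<Rightarrow> bool" where
  "continuous_operator A \<phi> \<equiv> \<forall>g\<in>Lmaps A. Y.continuous_family_at (Lmaps A) (sup_dist A) g \<phi>"

text \<open>Enlarging \<open>extensions A g\<close> by \<open>e\<close> turns lower semicontinuity
  into local constancy: an extension \<open>K\<close> of \<open>g\<close> is within \<open>e\<close>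
  of an extension of every nearby \<open>h\<close>. The set \<open>C g\<close> carries the condition
  of staying close to the previous approximation.\<close>

lemma approximate_extension_operator:
  assumes A: "A \<noteq> {}" and "e > 0"
    and conv: "\<And>g f f' t. \<lbrakk>g \<in> Lmaps A; f \<in> C g; f' \<in> C g; 0 \<le> t; t \<le> 1\<rbrakk> \<Longrightarrow> (\<lambda>x. cY t (f x) (f' x)) \<in> C g"
    and loc: "\<And>g. g \<in> Lmaps A \<Longrightarrow> \<exists>K\<in>extensions A g. \<exists>r>0. \<forall>h\<in>Lmaps A. sup_dist A g h < r \<longrightarrow> K \<in> C h"
  obtains \<phi> where "continuous_operator A \<phi>"
    and "\<And>g. g \<in> Lmaps A \<Longrightarrow> \<phi> g \<in> C g"
    and "\<And>g. g \<in> Lmaps A \<Longrightarrow> \<exists>K\<in>extensions A g. \<forall>x. dist (\<phi> g x) (K x) \<le> e"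
proof -
  define Q where "Q g = {f \<in> C g. \<exists>K\<in>extensions A g. \<forall>x. dist (f x) (K x) \<le> e}" for g
  have Qb: "bounded (range f)" if "g \<in> Lmaps A" "f \<in> Q g" for g f
    using that bounded_near_bounded[of _ f e] by (auto simp: Q_def extensions_def)
  have Qc: "(\<lambda>x. cY t (f x) (f' x)) \<in> Q g"
    if ff': "g \<in> Lmaps A" "f \<in> Q g" "f' \<in> Q g" "0 \<le> t" "t \<le> 1" for g f f' t
  proof -
    obtain K K' where K: "K \<in> extensions A g" "K' \<in> extensions A g"
      "\<And>x. dist (f x) (K x) \<le> e" "\<And>x. dist (f' x) (K' x) \<le> e"
      using ff' by (auto simp: Q_def)
    have 1: "(\<lambda>x. cY t (K x) (K' x)) \<in> extensions A g"
      by (rule Y.extensions_convex[OF K(1,2) ff'(4,5)])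
    have 2: "dist (cY t (f x) (f' x)) (cY t (K x) (K' x)) \<le> e" for x
      by (rule Y.dist_c_c_le[OF ff'(4,5) K(3,4)])
    have 3: "(\<lambda>x. cY t (f x) (f' x)) \<in> C g"
      using conv ff' by (simp add: Q_def)
    show ?thesis
      unfolding Q_def by (intro CollectI conjI bexI[OF _ 1] allI 2 3)
  qed
  have Ql: "\<exists>f. \<exists>r>0. \<forall>h\<in>Lmaps A. sup_dist A g h < r \<longrightarrow> f \<in> Q h" if g: "g \<in> Lmaps A" for g
  proof -
    obtain K r where K: "K \<in> extensions A g" "r > 0" "\<And>h. \<lbrakk>h \<in> Lmaps A; sup_dist A g h < r\<rbrakk> \<Longrightarrow> K \<in> C h"
      using loc[OF g] by blast
    obtain d where d: "d > 0" "\<And>h. \<lbrakk>h \<in> Lmaps A; \<And>a. a \<in> A \<Longrightarrow> dist (g a) (h a) \<le> d\<rbrakk> \<Longrightarrow>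
      \<exists>H\<in>extensions A h. \<forall>x. dist (K x) (H x) \<le> e"
      using extensions_lower_semicontinuous[OF g A K(1) \<open>e > 0\<close>] by metis
    have "K \<in> Q h" if h: "h \<in> Lmaps A" "sup_dist A g h < min r d" for h
    proof -
      have "dist (g a) (h a) \<le> d" if "a \<in> A" for a
        using dist_le_sup_dist[OF g h(1) that] h(2) by simp
      then show ?thesis using K(3) d(2) h by (simp add: Q_def)
    qed
    then show ?thesis using K(2) d(1) by (intro exI[of _ K] exI[of _ "min r d"]) auto
  qed
  obtain \<phi> where "\<And>g. g \<in> Lmaps A \<Longrightarrow> \<phi> g \<in> Q g"
    "\<And>g. g \<in> Lmaps A \<Longrightarrow> Y.continuous_family_at (Lmaps A) (sup_dist A) g \<phi>"
  proof (rule Y.continuous_selection[of "Lmaps A" "sup_dist A" Q])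
    show "sup_dist A g g = 0" for g :: "'a \<Rightarrow> 'b" by (rule sup_dist_self[OF A])
    show "sup_dist A g h = sup_dist A h g" for g h :: "'a \<Rightarrow> 'b" by (rule sup_dist_commute)
    show "sup_dist A g k \<le> sup_dist A g h + sup_dist A h k"
      if "g \<in> Lmaps A" "h \<in> Lmaps A" "k \<in> Lmaps A" for g h k :: "'a \<Rightarrow> 'b"
      by (rule sup_dist_triangle[OF A that])
    show "bounded (range f)" if "g \<in> Lmaps A" "f \<in> Q g" for g f by (rule Qb[OF that])
    show "(\<lambda>x. cY t (f x) (f' x)) \<in> Q g"
      if "g \<in> Lmaps A" "f \<in> Q g" "f' \<in> Q g" "0 \<le> t" "t \<le> 1" for g f f' t
      by (rule Qc[OF that])
    show "\<exists>f. \<exists>r>0. \<forall>h\<in>Lmaps A. sup_dist A g h < r \<longrightarrow> f \<in> Q h" if "g \<in> Lmaps A" for g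
      by (rule Ql[OF that])
  qed blast
  then show ?thesis by (intro that[of \<phi>]) (auto simp: Q_def)
qed

text \<open>Michael's argument: approximate selections of \<open>extensions A\<close>, each uniformly close to the
  previous one, converge to an exact continuous selection.\<close>

lemma continuous_extension_operator:
  assumes A: "A \<noteq> {}"
  obtains \<beta> where "continuous_operator A \<beta>"
    and "\<And>g. g \<in> Lmaps A \<Longrightarrow> \<beta> g \<in> extensions A g"
proof -
  define approx where "approx n \<phi> \<longleftrightarrow> continuous_operator A \<phi>
      \<and> (\<forall>g\<in>Lmaps A. \<exists>K\<in>extensions A g. \<forall>x. dist (\<phi> g x) (K x) \<le> (1/2) ^ n)" for n :: nat and \<phi>
  have init: "\<exists>\<phi>. approx 0 \<phi>"
  proof -
    have "\<exists>K\<in>extensions A g. \<exists>r>0. \<forall>h\<in>Lmaps A. sup_dist A g h < r \<longrightarrow> K \<in> UNIV"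
      if "g \<in> Lmaps A" for g :: "'a \<Rightarrow> 'b"
      using extension_exists[OF that A] zero_less_one by blast
    then obtain \<phi> where "continuous_operator A \<phi>"
      "\<And>g. g \<in> Lmaps A \<Longrightarrow> \<exists>K\<in>extensions A g. \<forall>x. dist (\<phi> g x) (K x) \<le> 1"
      using approximate_extension_operator[OF A zero_less_one, of "\<lambda>_. UNIV"] by auto
    then show ?thesis unfolding approx_def by auto
  qed
  have next_approx: "\<exists>\<psi>. approx (Suc n) \<psi> \<and> (\<forall>g\<in>Lmaps A. \<forall>x. dist (\<psi> g x) (\<phi> g x) \<le> 2 * (1/2) ^ n)"
    if \<phi>: "approx n \<phi>" for n \<phi>
  proof -
    \<comment> \<open>Twice \<open>(1/2) ^ n\<close>: once from \<open>K\<close> to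
      \<open>\<phi> g\<close>, and once from \<open>\<phi> g\<close> to \<open>\<phi> h\<close> for
      \<open>h\<close> near \<open>g\<close>.\<close>
    define C where "C g = {f. \<forall>x. dist (f x) (\<phi> g x) \<le> 2 * (1/2) ^ n}" for g
    have conv: "(\<lambda>x. cY t (f x) (f' x)) \<in> C g"
      if "f \<in> C g" "f' \<in> C g" "0 \<le> t" "t \<le> 1" for g f f' t
      using that by (auto simp: C_def intro: Y.dist_c_le)
    have loc: "\<exists>K\<in>extensions A g. \<exists>r>0. \<forall>h\<in>Lmaps A. sup_dist A g h < r \<longrightarrow> K \<in> C h"
      if g: "g \<in> Lmaps A" for g
    proof -
      obtain K where K: "K \<in> extensions A g" "\<And>x. dist (\<phi> g x) (K x) \<le> (1/2) ^ n"
        using \<phi> g unfolding approx_def by blast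
      have "Y.continuous_family_at (Lmaps A) (sup_dist A) g \<phi>"
        using \<phi> g unfolding approx_def by blast
      then obtain r where r: "r > 0"
        "\<And>h x. \<lbrakk>h \<in> Lmaps A; sup_dist A g h < r\<rbrakk> \<Longrightarrow> dist (\<phi> g x) (\<phi> h x) \<le> (1/2) ^ n"
        by (rule Y.continuous_family_atD[where e = "(1/2) ^ n"]) auto
      have "dist (K x) (\<phi> h x) \<le> 2 * (1/2) ^ n" if "h \<in> Lmaps A" "sup_dist A g h < r" for h x
        using dist_triangle3[of "K x" "\<phi> h x" "\<phi> g x"] K(2)[of x] r(2)[OF that, of x] by linarith
      then show ?thesis using K(1) r(1) unfolding C_def by blast
    qed
    have "(1/2 :: real) ^ Suc n > 0" by simp
    from approximate_extension_operator[where C = C, OF A this conv loc]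
    obtain \<psi> where "continuous_operator A \<psi>" "\<And>g. g \<in> Lmaps A \<Longrightarrow> \<psi> g \<in> C g"
      "\<And>g. g \<in> Lmaps A \<Longrightarrow> \<exists>K\<in>extensions A g. \<forall>x. dist (\<psi> g x) (K x) \<le> (1/2) ^ Suc n"
      by blast
    then show ?thesis unfolding approx_def C_def by blast
  qed
  obtain \<phi> where \<phi>: "\<And>n. approx n (\<phi> n)"
    and step: "\<And>n g x. g \<in> Lmaps A \<Longrightarrow> dist (\<phi> (Suc n) g x) (\<phi> n g x) \<le> 2 * (1/2) ^ n"
    using dependent_nat_choice[of approx
        "\<lambda>n \<phi> \<psi>. \<forall>g\<in>Lmaps A. \<forall>x. dist (\<psi> g x) (\<phi> g x) \<le> 2 * (1/2) ^ n", OF init next_approx] by metis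
  have "\<exists>l. \<forall>n. dist (\<phi> n g x) l \<le> 4 * (1/2) ^ n" if "g \<in> Lmaps A" for g x
    using geometric_limit[of "\<lambda>n. \<phi> n g x", OF step[OF that]] by metis
  then obtain \<beta> where \<beta>: "\<And>g x n. g \<in> Lmaps A \<Longrightarrow> dist (\<phi> n g x) (\<beta> g x) \<le> 4 * (1/2) ^ n"
    by metis
  have small: "\<exists>n. k * (1/2) ^ n \<le> e" if "e > 0" "k > 0" for e k :: real
  proof -
    have "e / k > 0" using that by simp
    then obtain n where "(1/2 :: real) ^ n < e / k" using real_arch_pow_inv[of "e / k" "1/2"] by auto
    then have "k * (1/2) ^ n \<le> e" using \<open>k > 0\<close> by (simp add: pos_less_divide_eq mult.commute less_imp_le)
    then show ?thesis by blast
  qed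
  show ?thesis
  proof (rule that[of \<beta>])
    show "\<beta> g \<in> extensions A g" if g: "g \<in> Lmaps A" for g
    proof (rule extensions_closed)
      fix e :: real assume "e > 0"
      \<comment> \<open>4 for the remaining steps from \<open>\<phi> n\<close> to the limit, 1 for
        the distance from \<open>\<phi> n\<close> to an extension.\<close>
      then obtain n where n: "5 * (1/2) ^ n \<le> e" using small[of e 5] by auto
      obtain K where K: "K \<in> extensions A g" "\<And>x. dist (\<phi> n g x) (K x) \<le> (1/2) ^ n"
        using \<phi>[of n] g unfolding approx_def by blast
      have "dist (\<beta> g x) (K x) \<le> e" for x
        using dist_triangle3[of "\<beta> g x" "K x" "\<phi> n g x"] K(2)[of x] \<beta>[OF g, of n x] n by linarith
      then show "\<exists>K\<in>extensions A g. \<forall>x. dist (\<beta> g x) (K x) \<le> e" using K(1) by blast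
    qed
    show "continuous_operator A \<beta>"
    proof
      fix g :: "'a \<Rightarrow> 'b" assume g: "g \<in> Lmaps A"
      show "Y.continuous_family_at (Lmaps A) (sup_dist A) g \<beta>"
        unfolding Y.continuous_family_at_def
      proof (intro allI impI)
        fix e :: real assume "e > 0"
        \<comment> \<open>Two passages to the limit cost 4 each, the continuity of
          \<open>\<phi> n\<close> costs 1.\<close>
        then obtain n where n: "9 * (1/2) ^ n \<le> e" using small[of e 9] by auto
        have "Y.continuous_family_at (Lmaps A) (sup_dist A) g (\<phi> n)"
          using \<phi>[of n] g unfolding approx_def by blast
        then obtain d where d: "d > 0"
          "\<And>h x. \<lbrakk>h \<in> Lmaps A; sup_dist A g h < d\<rbrakk> \<Longrightarrow> dist (\<phi> n g x) (\<phi> n h x) \<le> (1/2) ^ n"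
          by (rule Y.continuous_family_atD[where e = "(1/2) ^ n"]) auto
        have "dist (\<beta> g x) (\<beta> h x) \<le> e" if "h \<in> Lmaps A" "sup_dist A g h < d" for h x
          using dist_triangle3[of "\<beta> g x" "\<beta> h x" "\<phi> n g x"] dist_triangle[of "\<phi> n g x" "\<beta> h x" "\<phi> n h x"]
            d(2)[OF that, of x] \<beta>[OF g, of n x] \<beta>[OF that(1), of n x] n by linarith
        then show "\<exists>d>0. \<forall>h\<in>Lmaps A. sup_dist A g h < d \<longrightarrow> (\<forall>x. dist (\<beta> g x) (\<beta> h x) \<le> e)"
          using d(1) by blast
      qed
    qed
  qed
qed

end

text \<open>Elements of \<open>Lmaps A\<close> are total functions, and those that agree on
  \<open>A\<close> have \<open>sup_dist\<close> 0. The continuity clause forces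
  \<open>\<beta>\<close> to send them to the same map, so \<open>\<beta>\<close> does act on maps
  defined on \<open>A\<close>.\<close>

theorem theorem3p7:
  fixes A :: "'a::metric_space set"
  assumes X: "CBB0 (UNIV :: 'a set)"
    and Y: "CAT0 (UNIV :: 'b::complete_space set)"
    and A: "A \<noteq> {}"
  shows "\<exists>\<beta> :: ('a \<Rightarrow> 'b) \<Rightarrow> ('a \<Rightarrow> 'b).
           (\<forall>g\<in>Lmaps A. \<beta> g \<in> Lmaps UNIV) \<and>
           (\<forall>g\<in>Lmaps A. \<forall>e>0. \<exists>d>0. \<forall>h\<in>Lmaps A.
               sup_dist A g h < d \<longrightarrow> sup_dist UNIV (\<beta> g) (\<beta> h) < e) \<and>
           (\<forall>g\<in>Lmaps A. (\<forall>a\<in>A. \<beta> g a = g a) \<and> Lip (\<beta> g) UNIV = Lip g A)"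
proof -
  obtain cX :: "real \<Rightarrow> 'a \<Rightarrow> 'a \<Rightarrow> 'a" where "cbb0_interpolation cX"
    using X by (rule CBB0_interpolation)
  then interpret X: cbb0_interpolation cX .
  obtain cY :: "real \<Rightarrow> 'b \<Rightarrow> 'b \<Rightarrow> 'b" where "cat0_interpolation cY"
    using Y by (rule CAT0_interpolation)
  then interpret Y: cat0_interpolation cY .
  interpret kirszbraun cX cY by unfold_locales
  obtain \<beta> where cont: "continuous_operator A \<beta>" and ext: "\<And>g. g \<in> Lmaps A \<Longrightarrow> \<beta> g \<in> extensions A g"
    using A by (rule continuous_extension_operator) blast
  have "\<exists>d>0. \<forall>h\<in>Lmaps A. sup_dist A g h < d \<longrightarrow> sup_dist UNIV (\<beta> g) (\<beta> h) < e"
    if g: "g \<in> Lmaps A" and "e > 0" for g e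
  proof -
    \<comment> \<open>A pointwise bound passes to the supremum only as a weak inequality;
      \<open>e / 2\<close> makes it strict.\<close>
    have "e / 2 > 0" using \<open>e > 0\<close> by simp
    with bspec[OF cont g] obtain d where "d > 0"
      and d: "\<And>h x. \<lbrakk>h \<in> Lmaps A; sup_dist A g h < d\<rbrakk> \<Longrightarrow> dist (\<beta> g x) (\<beta> h x) \<le> e / 2"
      by (rule Y.continuous_family_atD) blast
    have "sup_dist UNIV (\<beta> g) (\<beta> h) < e" if "h \<in> Lmaps A" "sup_dist A g h < d" for h
      using sup_dist_le[of UNIV "\<beta> g" "\<beta> h" "e / 2"] d[OF that] \<open>e > 0\<close> by simp
    then show ?thesis using \<open>d > 0\<close> by blast
  qed
  then show ?thesis
    using extensions_Lmaps[OF _ ext] by (intro exI[of _ \<beta>]) simp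
qed

end
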